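(* Let $n\in\{1,\ldots,N\}$ be a stable station with $s_C^{(n)}>0$. Let $z_0^*=1,z_1^*,\ldots,z_{C-1}^*$ be the roots in the closed unit disk, listed according to multiplicity, of $$\mathcal{F}^{(n)}(z)=z^{C}-Y(z)\sum_{u=0}^{C}s_u^{(n)}z^{C-u}.$$ Then the distribution of $S^{(n)}$, these roots, and $\overline Y^{(n)}=\mathbb{E}[Y^{(n)}]$ determine the queue probabilities $q_{0:C-1}^{(n)}=[q_0^{(n)},\ldots,q_{C-1}^{(n)}]$, $q_k^{(n)}=\mathbb{P}(Q^{(n)}=k)$, through $$q_0^{(n)}=\frac{1}{s_C^{(n)}}\left(\overline S^{(n)}-\overline Y^{(n)}\right)\prod_{i=1}^{C-1}\frac{z_i^*}{z_i^*-1},\qquad q_{0:C-1}^{(n)}=\widetilde\eta^{(n)}\left(\Lambda^{(n)}\right)^{-1},$$ where $\overline S^{(n)}=\mathbb{E}[S^{(n)}]=\sum_{u=0}^{C}u\,s_u^{(n)}$, the coefficients $\eta_j^{(n)}$ are defined by $\sum_{j=0}^{C}\eta_j^{(n)}z^j=\prod_{i=0}^{C-1}(1-z/z_i^* )$, $$\widetilde\eta^{(n)}=\left[s_C^{(n)}q_0^{(n)}\eta_0^{(n)},\,s_C^{(n)}q_0^{(n)}\eta_1^{(n)},\ldots,s_C^{(n)}q_0^{(n)}\eta_{C-1}^{(n)}\right]\in\mathbb{R}^{C},$$ and $$\Lambda^{(n)}=\begin{bmatrix} s_C^{(n)} & s_{C-1}^{(n)} & \cdots & s_2^{(n)} & s_1^{(n)}\\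 0 & s_C^{(n)} & \cdots & s_3^{(n)} & s_2^{(n)}\\ \vdots & \ddots & \ddots & \vdots & \vdots\\ 0&\cdots&0&s_C^{(n)}&s_{C-1}^{(n)}\\ 0&\cdots&\cdots&0&s_C^{(n)}\end{bmatrix}\in\mathbb{R}^{C\times C}.$$ A root of multiplicity $m$ appears $m$ times in the products.
   Context: Station model (bulk service queue) with integer vehicle capacity $C\ge1$. $Q^{(n,l)}$ is the number of passengers waiting at station $n$ when vehicle $l$ arrives; $S^{(n,l)}\in\{0,\ldots,C\}$ is the available space of vehicle $l$; $R^{(n,l)}=\max\{0,Q^{(n,l)}-S^{(n,l)}\}$ is the number left behind; and $Q^{(n,l+1)}=R^{(n,l)}+Y^{(n,l)}$, where $Y^{(n,l)}$ is the number of Poisson arrivals (rate $\lambda^{(n)}\ge0$) in the headway following vehicle $l$; conditional on a headway of length $h\ge0$, it is Poisson with mean $\lambda^{(n)}h$. The $S^{(n,l)}$ are i.i.d. with distribution $s^{(n)}=[s_0^{(n)},\ldots,s_C^{(n)}]$ (generic variable $S^{(n)}$), independent of headways, local arrivals and local queue history. Headways are nonnegative, i.i.d., each independent of all prior headways and of prior queue and load states; hence the $Y^{(n,l)}$ are i.i.d. (generic variable $Y^{(n)}$, probability generating function $Y(z)$) and $Y^{(n,l)}$ is independent of $R^{(n,l)}$. (The common headway law is that of $\max\{0,\widehat H\}$ with $\widehat H=\overline H+\frac{2\gamma T^{(N)}}{\theta\overline F}+I-I'$, where $I,I'$ are i.i.d. sums of a Poisson($\gamma T^{(n)}$) number of independent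 exponential($\theta$) variables, or its approximation in which $\widehat H$ is replaced by a normal variable with the same mean and variance; $\overline H,\overline F,\theta,T^{(n)},T^{(N)}>0$, $\gamma\ge0$ are constants.) Stability means that the queue process has a proper stationary distribution, which here is equivalent to $\overline Y^{(n)}<\overline S^{(n)}$; $Q^{(n)}$ has the steady state distribution of $Q^{(n,l)}$. Under these conditions $\mathcal{F}^{(n)}$ has exactly $C$ roots in the closed unit disk counted with multiplicity, $z=1$ is a simple root, and $0$ is not a root. *)

theory Defs
  imports
    "HOL-Probability.Probability"
    "HOL-Complex_Analysis.Complex_Analysis"
    "Jordan_Normal_Form.Gauss_Jordan_Elimination"
begin

(* The library's poisson_pmf is only specified for positive rates. *)
definition poisson_law :: "real \<Rightarrow> nat pmf" where
  "poisson_law r = (if r > 0 then poisson_pmf r else return_pmf 0)"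

(* Law of E_0 + ... + E_{K-1} with K ~ Poisson(r) and E_0, E_1, ... ~ Exp(theta), all independent. *)
definition poisson_exp_sum_law :: "real \<Rightarrow> real \<Rightarrow> real measure" where
  "poisson_exp_sum_law r \<theta> =
     distr (measure_pmf (poisson_law r) \<Otimes>\<^sub>M
              (\<Pi>\<^sub>M i\<in>(UNIV :: nat set). density lborel (exponential_density \<theta>)))
       borel (\<lambda>(k, e). \<Sum>i<k. e i)"

(* Law of Hbar + 2 gamma TN / (theta Fbar) + I - I', where I and I' are independent.
   Tn and TN stand for T^(n) and T^(N). *)
definition raw_headway_law ::
  "real \<Rightarrow> real \<Rightarrow> real \<Rightarrow> real \<Rightarrow> real \<Rightarrow> real \<Rightarrow> real measure" where
  "raw_headway_law \<gamma> \<theta> Hbar Fbar Tn TN =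
     distr (poisson_exp_sum_law (\<gamma> * Tn) \<theta> \<Otimes>\<^sub>M poisson_exp_sum_law (\<gamma> * Tn) \<theta>) borel
       (\<lambda>(x, x'). Hbar + 2 * \<gamma> * TN / (\<theta> * Fbar) + x - x')"

(* Variance 0, which occurs for gamma = 0, has to be treated apart since
   normal_density is not a probability density then. *)
definition normal_law :: "real \<Rightarrow> real \<Rightarrow> real measure" where
  "normal_law m v =
     (if v = 0 then return borel m else density lborel (normal_density m (sqrt v)))"

definition normal_approx :: "real measure \<Rightarrow> real measure" where
  "normal_approx L =
     (let m = (\<integral>x. x \<partial>L) in normal_law m (\<integral>x. (x - m)\<^sup>2 \<partial>L))"

definition headway_laws ::
  "real \<Rightarrow> real \<Rightarrow> real \<Rightarrow> real \<Rightarrow> real \<Rightarrow> real \<Rightarrow> real measure set" where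
  "headway_laws \<gamma> \<theta> Hbar Fbar Tn TN =
     (let L = raw_headway_law \<gamma> \<theta> Hbar Fbar Tn TN
      in {distr L borel (max 0), distr (normal_approx L) borel (max 0)})"

(* indep_var requires both variables to have the same range type. *)
definition (in prob_space) indep_rvs ::
  "'b measure \<Rightarrow> ('a \<Rightarrow> 'b) \<Rightarrow> 'c measure \<Rightarrow> ('a \<Rightarrow> 'c) \<Rightarrow> bool" where
  "indep_rvs N X N' X' \<longleftrightarrow>
     indep_set (sets (vimage_algebra (space M) X N)) (sets (vimage_algebra (space M) X' N'))"

(* One station; the sequences are indexed by the vehicle l.  The three blocks Q 0, S and
   (H, Y) are independent of one another and the entries of the last two are i.i.d.; since Q l
   is a function of Q 0 and of the S and Y of earlier vehicles, S l and (H l, Y l) are thus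
   independent of each other and of the whole history up to the arrival of vehicle l. *)
locale station_model = prob_space M for M :: "'a measure" +
  fixes C :: nat
    and lam :: real
    and s :: "nat \<Rightarrow> real"
    and \<gamma> \<theta> Hbar Fbar Tn TN :: real
    and Q S :: "nat \<Rightarrow> 'a \<Rightarrow> nat"
    and H :: "nat \<Rightarrow> 'a \<Rightarrow> real"
    and Y :: "nat \<Rightarrow> 'a \<Rightarrow> nat"
  assumes C_ge_1: "1 \<le> C"
    and lam_nonneg: "0 \<le> lam"
    and gamma_nonneg: "0 \<le> \<gamma>"
    and pos: "0 < \<theta>" "0 < Hbar" "0 < Fbar" "0 < Tn" "0 < TN"
    and measurable_Q [measurable]: "\<And>l. Q l \<in> measurable M (count_space UNIV)"
    and measurable_S [measurable]: "\<And>l. S l \<in> measurable M (count_space UNIV)"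
    and measurable_H [measurable]: "\<And>l. H l \<in> borel_measurable M"
    and measurable_Y [measurable]: "\<And>l. Y l \<in> measurable M (count_space UNIV)"
    and S_le: "\<And>l \<omega>. \<omega> \<in> space M \<Longrightarrow> S l \<omega> \<le> C"
    and S_law: "\<And>l u. u \<le> C \<Longrightarrow> prob {\<omega> \<in> space M. S l \<omega> = u} = s u"
    and H_nonneg: "\<And>l \<omega>. \<omega> \<in> space M \<Longrightarrow> 0 \<le> H l \<omega>"
    and H_law: "\<exists>L \<in> headway_laws \<gamma> \<theta> Hbar Fbar Tn TN. \<forall>l. distr M borel (H l) = L"
    and Y_given_H: "\<And>l A k. A \<in> sets borel \<Longrightarrow>
          prob {\<omega> \<in> space M. H l \<omega> \<in> A \<and> Y l \<omega> = k} =
          (\<integral>\<omega>. indicator A (H l \<omega>) * pmf (poisson_law (lam * H l \<omega>)) k \<partial>M)"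
    and S_indep: "indep_vars (\<lambda>_. count_space UNIV) S UNIV"
    and HY_indep: "indep_vars (\<lambda>_. borel \<Otimes>\<^sub>M count_space UNIV) (\<lambda>l \<omega>. (H l \<omega>, Y l \<omega>)) UNIV"
    and S_indep_Q_HY: "indep_rvs
          (\<Pi>\<^sub>M l\<in>UNIV. count_space UNIV) (\<lambda>\<omega> l. S l \<omega>)
          (count_space UNIV \<Otimes>\<^sub>M (\<Pi>\<^sub>M l\<in>UNIV. borel \<Otimes>\<^sub>M count_space UNIV))
          (\<lambda>\<omega>. (Q 0 \<omega>, \<lambda>l. (H l \<omega>, Y l \<omega>)))"
    and Q_indep_HY: "indep_rvs
          (count_space UNIV) (Q 0)
          (\<Pi>\<^sub>M l\<in>UNIV. borel \<Otimes>\<^sub>M count_space UNIV) (\<lambda>\<omega> l. (H l \<omega>, Y l \<omega>))"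
    (* Subtraction on nat truncates: Q l - S l is the number of passengers left behind. *)
    and Q_Suc: "\<And>l \<omega>. \<omega> \<in> space M \<Longrightarrow> Q (Suc l) \<omega> = (Q l \<omega> - S l \<omega>) + Y l \<omega>"

(* P(Q (l+1) = k | Q l = j).  Vehicle 0 stands for any l: S l and Y l are independent of Q l
   and of each other, and their laws do not depend on l. *)
definition queue_trans ::
  "'a measure \<Rightarrow> (nat \<Rightarrow> 'a \<Rightarrow> nat) \<Rightarrow> (nat \<Rightarrow> 'a \<Rightarrow> nat) \<Rightarrow> nat \<Rightarrow> nat \<Rightarrow> real" where
  "queue_trans M S Y j k = measure M {\<omega> \<in> space M. (j - S 0 \<omega>) + Y 0 \<omega> = k}"

(* Stability of the station is the existence of such a q, which is proper, being a pmf. *)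
definition stationary_queue ::
  "'a measure \<Rightarrow> (nat \<Rightarrow> 'a \<Rightarrow> nat) \<Rightarrow> (nat \<Rightarrow> 'a \<Rightarrow> nat) \<Rightarrow> nat pmf \<Rightarrow> bool" where
  "stationary_queue M S Y q \<longleftrightarrow>
     (\<forall>k. (\<lambda>j. pmf q j * queue_trans M S Y j k) sums pmf q k)"

definition mean :: "'a measure \<Rightarrow> ('a \<Rightarrow> nat) \<Rightarrow> real" where
  "mean M X = (\<integral>\<omega>. real (X \<omega>) \<partial>M)"

definition pgf :: "'a measure \<Rightarrow> ('a \<Rightarrow> nat) \<Rightarrow> complex \<Rightarrow> complex" where
  "pgf M X z = (\<integral>\<omega>. z ^ X \<omega> \<partial>M)"

definition station_fn :: "nat \<Rightarrow> (nat \<Rightarrow> real) \<Rightarrow> (complex \<Rightarrow> complex) \<Rightarrow> complex \<Rightarrow> complex" where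
  "station_fn C s G z = z ^ C - G z * (\<Sum>u\<le>C. of_real (s u) * z ^ (C - u))"

(* In the use below f is analytic on a neighbourhood of the closed disk, since the
   headway laws have an exponential moment; so zorder is the multiplicity. *)
definition lists_unit_disk_roots ::
  "(complex \<Rightarrow> complex) \<Rightarrow> nat \<Rightarrow> (nat \<Rightarrow> complex) \<Rightarrow> bool" where
  "lists_unit_disk_roots f m z \<longleftrightarrow>
     (\<forall>i<m. norm (z i) \<le> 1 \<and> f (z i) = 0) \<and>
     (\<forall>w. norm w \<le> 1 \<and> f w = 0 \<longrightarrow> int (card {i. i < m \<and> z i = w}) = zorder f w)"

definition eta :: "nat \<Rightarrow> (nat \<Rightarrow> complex) \<Rightarrow> nat \<Rightarrow> complex" where
  "eta C z j = Polynomial.coeff (\<Prod>i<C. [:1, - 1 / z i:]) j"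

definition eta_tilde ::
  "nat \<Rightarrow> (nat \<Rightarrow> real) \<Rightarrow> real \<Rightarrow> (nat \<Rightarrow> complex) \<Rightarrow> complex Matrix.vec" where
  "eta_tilde C s q0 z = Matrix.vec C (\<lambda>j. of_real (s C) * of_real q0 * eta C z j)"

definition Lambda_mat :: "nat \<Rightarrow> (nat \<Rightarrow> real) \<Rightarrow> real Matrix.mat" where
  "Lambda_mat C s = Matrix.mat C C (\<lambda>(i, j). if i \<le> j then s (C - (j - i)) else 0)"

end

theory Submission
  imports
    Defs
    "HOL-Computational_Algebra.Fundamental_Theorem_Algebra"
    "Jordan_Normal_Form.Determinant"
begin

text \<open>
  Write A for the probability generating function of the stationary queue q.  The balance
  equation says F A = Y P on the closed unit disk, where F is the station function and P is a
  polynomial of degree at most C whose coefficients below C are those of -q Lambda.  The headway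
  laws have an exponential moment, so Y and F are analytic on a larger disk.  As A is bounded and
  Y does not vanish at a root of F, P vanishes at every such root to at least the order of F;
  the C listed roots therefore exhaust the roots of P, and P = -s_C q_0 prod (1 - z/z_i).
  Comparing coefficients gives q Lambda = eta_tilde, and letting z tend to 1 gives
  P'(1) = F'(1) = E S - E Y, which is the formula for q_0.  Moreover P'(1) > 0, since otherwise
  q_0, ..., q_(C-1) and hence P would vanish, although F does not; so no root but z_0 equals 1.
\<close>

section \<open>The analytic argument\<close>

text \<open>The locale \<open>queue_equation\<close> keeps measure theory out of the analytic half:
  the model enters it only through number sequences and one power series. Room beyond the unit disk
  is needed twice, for \<open>zorder\<close> at roots on the circle itself and for the derivative of
  Y at 1; both are the reason for carrying a radius \<open>\<rho>\<close> > 1. For A no such room is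
  at hand, a priori not even a finite mean queue length. Near the circle A is therefore used only
  through |A| <= 1 and through its continuity on the closed disk. Nonvanishing of P, on which every
  comparison of orders and degrees rests, comes from the other end of the disk, from the behaviour
  of F and A near 0.\<close>

lemma order_ge_if_norm_poly_le:
  fixes P :: "complex poly"
  assumes "P \<noteq> 0" and "w islimpt S"
    and bound: "\<forall>\<^sub>F x in at w within S. norm (poly P x) \<le> B * norm (x - w) ^ n"
  shows "n \<le> Polynomial.order w P"
proof (rule ccontr)
  define m where "m = Polynomial.order w P"
  assume "\<not> n \<le> Polynomial.order w P"
  then have "m < n" by (simp add: m_def)
  obtain R where R: "P = [:-w, 1:] ^ m * R" "\<not> [:-w, 1:] dvd R"
    using order_decomp[OF \<open>P \<noteq> 0\<close>, of w] by (auto simp: m_def)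
  have Rw: "poly R w \<noteq> 0" using R(2) by (simp add: poly_eq_0_iff_dvd)
  have nontriv: "at w within S \<noteq> bot"
    using \<open>w islimpt S\<close> by (simp add: trivial_limit_within)
  have "\<forall>\<^sub>F x in at w within S. x \<noteq> w"
    by (simp add: eventually_at_filter)
  \<comment> \<open>Dividing by (x - w)^m leaves the cofactor \<open>R\<close> with R(w) nonzero,
    yet bounded by a positive power of |x - w|; the limit along \<open>S\<close> contradicts
    this.\<close>
  with bound have "\<forall>\<^sub>F x in at w within S. norm (poly R x) \<le> B * norm (x - w) ^ (n - m)"
  proof eventually_elim
    case (elim x)
    have "norm (x - w) ^ m * norm (poly R x) = norm (poly P x)"
      by (simp add: R(1) norm_mult norm_power)
    also have "\<dots> \<le> norm (x - w) ^ m * (B * norm (x - w) ^ (n - m))"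
      using elim \<open>m < n\<close> by (simp add: mult.left_commute flip: power_add)
    finally show ?case using elim by simp
  qed
  moreover have "((\<lambda>x. norm (poly R x)) \<longlongrightarrow> norm (poly R w)) (at w within S)"
    by (intro tendsto_intros)
  moreover have "((\<lambda>x. B * norm (x - w) ^ (n - m)) \<longlongrightarrow> B * norm (w - w) ^ (n - m)) (at w within S)"
    by (intro tendsto_intros)
  ultimately have "norm (poly R w) \<le> B * norm (w - w) ^ (n - m)"
    by (intro tendsto_le[OF nontriv])
  then show False using Rw \<open>m < n\<close> by (simp add: power_0_left)
qed

text \<open>
  The laws of available space, arrivals and stationary queue are s, p and q.  In the balance
  equation, j - u truncates: it is the number left behind from a queue of length j.
\<close>

locale queue_equation =
  fixes C :: nat and s p q :: "nat \<Rightarrow> real" and G :: "complex \<Rightarrow> complex" and \<rho> :: real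
  assumes C_ge_1: "1 \<le> C"
    and s_nonneg: "\<And>u. u \<le> C \<Longrightarrow> 0 \<le> s u" and s_sum: "(\<Sum>u\<le>C. s u) = 1" and s_C_pos: "0 < s C"
    and p_nonneg: "\<And>k. 0 \<le> p k" and p_0_pos: "0 < p 0" and p_sums: "p sums 1"
    and q_nonneg: "\<And>k. 0 \<le> q k" and q_sums: "q sums 1"
    and rho_gt_1: "1 < \<rho>"
    and G_sums: "\<And>z. norm z < \<rho> \<Longrightarrow> (\<lambda>k. of_real (p k) * z ^ k) sums G z"
    and balance: "\<And>k. q k = (\<Sum>u\<le>C. s u * (\<Sum>j\<le>k + u. q j * p (k - (j - u))))"
begin

definition queue_pgf :: "complex \<Rightarrow> complex" where
  "queue_pgf z = (\<Sum>k. of_real (q k) * z ^ k)"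

text \<open>The probability that m passengers are left behind by a vehicle with space u.\<close>

definition left_behind :: "nat \<Rightarrow> nat \<Rightarrow> real" where
  "left_behind u m = (if m = 0 then \<Sum>j\<le>u. q j else q (m + u))"

text \<open>Space u leaves behind a number with generating function z^(-u) (A(z) - sum_{j<u} q_j
  z^j) + sum_{j<u} q_j. After multiplication by s_u z^C and summation over u, these are the terms
  free of A.\<close>

definition boundary_poly :: "complex poly" where
  "boundary_poly = (\<Sum>u\<le>C. Polynomial.smult (of_real (s u))
            (\<Sum>j<u. Polynomial.smult (of_real (q j)) (Polynomial.monom 1 C - Polynomial.monom 1 (C - u + j))))"

section \<open>Power series of the laws on the closed unit disk\<close>

lemma summable_norm_q: "norm z \<le> 1 \<Longrightarrow> summable (\<lambda>k. norm (complex_of_real (q k) * z ^ k))"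
  by (rule summable_comparison_test[OF _ sums_summable[OF q_sums]])
     (auto simp: norm_mult norm_power q_nonneg power_le_one intro!: exI[of _ 0] mult_left_le)

lemma summable_norm_p: "norm z \<le> 1 \<Longrightarrow> summable (\<lambda>k. norm (complex_of_real (p k) * z ^ k))"
  by (rule summable_comparison_test[OF _ sums_summable[OF p_sums]])
     (auto simp: norm_mult norm_power p_nonneg power_le_one intro!: exI[of _ 0] mult_left_le)

lemma queue_pgf_sums: "norm z \<le> 1 \<Longrightarrow> (\<lambda>k. of_real (q k) * z ^ k) sums queue_pgf z"
  unfolding queue_pgf_def by (rule summable_sums[OF summable_norm_cancel[OF summable_norm_q]])

lemma norm_queue_pgf_le: 
  assumes "norm z \<le> 1" shows "norm (queue_pgf z) \<le> 1"
proof -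
  have "norm (queue_pgf z) \<le> (\<Sum>k. norm (complex_of_real (q k) * z ^ k))"
    unfolding queue_pgf_def by (rule summable_norm[OF summable_norm_q[OF assms]])
  also have "\<dots> \<le> (\<Sum>k. q k)"
    using assms by (intro suminf_le summable_norm_q sums_summable[OF q_sums])
     (auto simp: norm_mult norm_power q_nonneg power_le_one intro!: mult_left_le)
  finally show ?thesis using q_sums by (simp add: sums_iff)
qed

lemma queue_pgf_1: "queue_pgf 1 = 1"
proof -
  have "(\<lambda>k. complex_of_real (q k)) sums of_real 1"
    using q_sums by (simp only: sums_of_real_iff)
  then show ?thesis using queue_pgf_sums[of 1] by (simp add: sums_iff)
qed

text \<open>The series of \<open>q\<close> itself is a majorant on the whole closed disk, so
  continuity reaches the circle; it is used at the point 1.\<close>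

lemma continuous_on_queue_pgf: "continuous_on (cball 0 1) queue_pgf"
proof -
  have "uniform_limit (cball 0 1) (\<lambda>n z. \<Sum>k<n. complex_of_real (q k) * z ^ k) 
      (\<lambda>z. \<Sum>k. of_real (q k) * z ^ k) sequentially"
    by (rule Weierstrass_m_test[OF _ sums_summable[OF q_sums]])
       (auto simp: norm_mult norm_power q_nonneg power_le_one intro!: mult_left_le)
  then have "uniform_limit (cball 0 1) (\<lambda>n z. \<Sum>k<n. complex_of_real (q k) * z ^ k) queue_pgf sequentially"
    by (simp add: queue_pgf_def[abs_def])
  then show ?thesis
    by (rule uniform_limit_theorem[rotated]) (auto intro!: always_eventually continuous_intros)
qed

text \<open>All queues with j <= u leave 0 behind, and m > 0 arises from j = m + u alone. Grouping
  by m turns the balance into a convolution with \<open>p\<close>, to which the Cauchy product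
  applies.\<close>

lemma balance': "q k = (\<Sum>m\<le>k. (\<Sum>u\<le>C. s u * left_behind u m) * p (k - m))"
proof -
  have "(\<Sum>j\<le>k + u. q j * p (k - (j - u))) = (\<Sum>m\<le>k. left_behind u m * p (k - m))" for u
  proof -
    have "(\<Sum>j\<le>k + u. q j * p (k - (j - u)))
        = (\<Sum>j\<le>u. q j * p (k - (j - u))) + (\<Sum>j\<in>{u<..k + u}. q j * p (k - (j - u)))"
      by (subst sum.union_disjoint[symmetric]) (auto intro!: sum.cong)
    also have "(\<Sum>j\<le>u. q j * p (k - (j - u))) = (\<Sum>j\<le>u. q j) * p k"
      by (simp add: sum_distrib_right)
    also have "(\<Sum>j\<in>{u<..k + u}. q j * p (k - (j - u))) = (\<Sum>m\<in>{0<..k}. left_behind u m * p (k - m))"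
      by (rule sum.reindex_bij_witness[of _ "\<lambda>m. m + u" "\<lambda>j. j - u"]) (auto simp: left_behind_def)
    also have "(\<Sum>j\<le>u. q j) * p k = (\<Sum>m\<in>{0}. left_behind u m * p (k - m))"
      by (simp add: left_behind_def)
    also have "(\<Sum>m\<in>{0}. left_behind u m * p (k - m)) + (\<Sum>m\<in>{0<..k}. left_behind u m * p (k - m))
        = (\<Sum>m\<in>{0} \<union> {0<..k}. left_behind u m * p (k - m))"
      by (rule sum.union_disjoint[symmetric]) auto
    also have "{0} \<union> {0<..k} = {..k}" by auto
    finally show ?thesis .
  qed
  then have "q k = (\<Sum>u\<le>C. s u * (\<Sum>m\<le>k. left_behind u m * p (k - m)))"
    using balance[of k] by simp
  also have "\<dots> = (\<Sum>m\<le>k. (\<Sum>u\<le>C. s u * left_behind u m) * p (k - m))"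
    by (simp add: sum_distrib_left sum_distrib_right mult.assoc) (rule sum.swap)
  finally show ?thesis .
qed

text \<open>The second part is multiplied through by z^u so that it also holds at z = 0.\<close>

lemma left_behind_sums:
  assumes "norm z \<le> 1"
  shows "(\<lambda>m. of_real (left_behind u m) * z ^ m) sums
           ((\<Sum>m. of_real (q (m + u)) * z ^ m) + (\<Sum>j<u. of_real (q j)))"
    and "z ^ u * (\<Sum>m. of_real (q (m + u)) * z ^ m) = queue_pgf z - (\<Sum>j<u. of_real (q j) * z ^ j)"
proof -
  have "summable (\<lambda>k. norm (complex_of_real (q (k + u)) * z ^ k))"
    by (rule summable_comparison_test[OF _ summable_ignore_initial_segment[OF sums_summable[OF q_sums], of u]])
       (use assms in \<open>auto simp: norm_mult norm_power q_nonneg power_le_one intro!: exI[of _ 0] mult_left_le\<close>)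
  then have 1: "(\<lambda>m. of_real (q (m + u)) * z ^ m) sums (\<Sum>m. of_real (q (m + u)) * z ^ m)"
    by (rule summable_sums[OF summable_norm_cancel])
  \<comment> \<open>At m = 0 the summand j = u is the constant term of the shifted series, so only
    the sum over j < u remains as an extra constant.\<close>
  have "{..u} = insert u {..<u}" by auto
  then have "(\<lambda>m. complex_of_real (left_behind u m) * z ^ m) = 
    (\<lambda>m. of_real (q (m + u)) * z ^ m + (if m = 0 then (\<Sum>j<u. of_real (q j)) else 0))"
    by (auto simp: left_behind_def fun_eq_iff)
  then show "(\<lambda>m. of_real (left_behind u m) * z ^ m) sums
           ((\<Sum>m. of_real (q (m + u)) * z ^ m) + (\<Sum>j<u. of_real (q j)))"
    using sums_add[OF 1 sums_single[of 0 "\<lambda>_. (\<Sum>j<u. complex_of_real (q j))"]] by simp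
  have "(\<lambda>m. of_real (q (m + u)) * z ^ (m + u)) sums (queue_pgf z - (\<Sum>j<u. of_real (q j) * z ^ j))"
    using sums_split_initial_segment[OF queue_pgf_sums[OF assms], of u] by simp
  moreover have "(\<lambda>m. of_real (q (m + u)) * z ^ (m + u)) sums (z ^ u * (\<Sum>m. of_real (q (m + u)) * z ^ m))"
    using sums_mult[OF 1, of "z ^ u"] by (simp add: power_add mult_ac)
  ultimately show "z ^ u * (\<Sum>m. of_real (q (m + u)) * z ^ m) = queue_pgf z - (\<Sum>j<u. of_real (q j) * z ^ j)"
    by (rule sums_unique2[symmetric])
qed

lemma poly_boundary_poly: "poly boundary_poly z = (\<Sum>u\<le>C. of_real (s u) * (\<Sum>j<u. of_real (q j) * (z ^ C - z ^ (C - u + j))))"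
  by (simp add: boundary_poly_def poly_sum poly_monom)

lemma station_fn_mult_queue_pgf:
  assumes z: "norm z \<le> 1"
  shows "station_fn C s G z * queue_pgf z = G z * poly boundary_poly z"
proof -
  \<comment> \<open>The generating function of the number left behind, averaged over the available
    space.\<close>
  define R where "R = (\<Sum>u\<le>C. of_real (s u) *
      ((\<Sum>m. of_real (q (m + u)) * z ^ m) + (\<Sum>j<u. complex_of_real (q j))))"
  have R: "(\<lambda>m. of_real (\<Sum>u\<le>C. s u * left_behind u m) * z ^ m) sums R"
  proof -
    have "(\<lambda>m. \<Sum>u\<le>C. of_real (s u) * (of_real (left_behind u m) * z ^ m)) sums R"
      unfolding R_def by (intro sums_sum sums_mult left_behind_sums z)
    then show ?thesis by (simp add: sum_distrib_right mult.assoc)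
  qed
  have G: "(\<lambda>k. of_real (p k) * z ^ k) sums G z" using G_sums z rho_gt_1 by simp
  have lb_nonneg: "0 \<le> (\<Sum>u\<le>C. s u * left_behind u m)" for m
    by (auto intro!: sum_nonneg mult_nonneg_nonneg s_nonneg q_nonneg simp: left_behind_def)
  have R_norm: "summable (\<lambda>m. norm (complex_of_real (\<Sum>u\<le>C. s u * left_behind u m) * z ^ m))"
  proof (rule summable_comparison_test)
    \<comment> \<open>The series at z = 1 is the majorant for the absolute convergence that the
      Cauchy product requires.\<close>
    have "summable (left_behind u)" for u
    proof -
      have "summable (\<lambda>m. complex_of_real (left_behind u m))"
        using left_behind_sums(1)[of 1 u] by (simp add: sums_iff)
      then show ?thesis by (simp only: summable_of_real_iff)
    qed
    then show "summable (\<lambda>m. \<Sum>u\<le>C. s u * left_behind u m)"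
      by (intro summable_sum summable_mult)
    show "\<exists>N. \<forall>n\<ge>N. norm (norm (complex_of_real (\<Sum>u\<le>C. s u * left_behind u n) * z ^ n))
        \<le> (\<Sum>u\<le>C. s u * left_behind u n)"
      using z lb_nonneg
      by (auto simp: norm_mult norm_power power_le_one intro!: mult_left_le exI[of _ 0] simp del: of_real_sum)
  qed
  have "queue_pgf z = R * G z"
  proof -
    have "(\<lambda>k. \<Sum>i\<le>k. (of_real (\<Sum>u\<le>C. s u * left_behind u i) * z ^ i) * (of_real (p (k - i)) * z ^ (k - i)))
       sums (R * G z)"
      using Cauchy_product_sums[OF R_norm summable_norm_p[OF z]] R G by (simp add: sums_iff)
    also have "(\<lambda>k. \<Sum>i\<le>k. (of_real (\<Sum>u\<le>C. s u * left_behind u i) * z ^ i) * (of_real (p (k - i)) * z ^ (k - i)))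
      = (\<lambda>k. of_real (q k) * z ^ k)"
    proof
      fix k
      have "(\<Sum>i\<le>k. (of_real (\<Sum>u\<le>C. s u * left_behind u i) * z ^ i) * (of_real (p (k - i)) * z ^ (k - i)))
       = (\<Sum>i\<le>k. of_real ((\<Sum>u\<le>C. s u * left_behind u i) * p (k - i)) * z ^ k)"
      proof (rule sum.cong)
        fix i assume "i \<in> {..k}"
        then have "z ^ k = z ^ i * z ^ (k - i)" by (simp flip: power_add)
        then show "(of_real (\<Sum>u\<le>C. s u * left_behind u i) * z ^ i) * (of_real (p (k - i)) * z ^ (k - i))
          = of_real ((\<Sum>u\<le>C. s u * left_behind u i) * p (k - i)) * z ^ k"
          by (simp only: of_real_mult mult_ac)
      qed simp
      also have "\<dots> = of_real (q k) * z ^ k"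
        unfolding balance'[symmetric] of_real_sum[symmetric] sum_distrib_right[symmetric] ..
      finally show "(\<Sum>i\<le>k. (of_real (\<Sum>u\<le>C. s u * left_behind u i) * z ^ i) * (of_real (p (k - i)) * z ^ (k - i)))
        = of_real (q k) * z ^ k" .
    qed
    finally show ?thesis using queue_pgf_sums[OF z] by (rule sums_unique2[symmetric])
  qed
  moreover have "z ^ C * R = (\<Sum>u\<le>C. of_real (s u) * z ^ (C - u)) * queue_pgf z + poly boundary_poly z"
  proof -
    have "z ^ C * (of_real (s u) * ((\<Sum>m. of_real (q (m + u)) * z ^ m) + (\<Sum>j<u. of_real (q j))))
       = of_real (s u) * z ^ (C - u) * queue_pgf z
         + of_real (s u) * (\<Sum>j<u. of_real (q j) * (z ^ C - z ^ (C - u + j)))" if "u \<le> C" for u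
    proof -
      have zC: "z ^ C = z ^ (C - u) * z ^ u" using that by (simp flip: power_add)
      have 1: "z ^ C * (\<Sum>m. of_real (q (m + u)) * z ^ m) = z ^ (C - u) * (queue_pgf z - (\<Sum>j<u. of_real (q j) * z ^ j))"
        unfolding zC mult.assoc left_behind_sums(2)[OF z] ..
      have 2: "(\<Sum>j<u. of_real (q j) * (z ^ C - z ^ (C - u + j)))
        = z ^ C * (\<Sum>j<u. of_real (q j)) - z ^ (C - u) * (\<Sum>j<u. of_real (q j) * z ^ j)"
        by (simp add: sum_subtractf right_diff_distrib sum_distrib_left power_add mult_ac)
      show ?thesis unfolding distrib_left mult.left_commute[of "z ^ C"] 1 2 by (simp add: algebra_simps)
    qed
    then show ?thesis
        unfolding R_def poly_boundary_poly sum_distrib_left[of "z ^ C"] sum_distrib_right sum.distrib[symmetric]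
      by (intro sum.cong) (auto simp: mult.assoc)
  qed
  ultimately have "z ^ C * queue_pgf z = ((\<Sum>u\<le>C. of_real (s u) * z ^ (C - u)) * queue_pgf z + poly boundary_poly z) * G z"
    by (metis mult.assoc)
  then show ?thesis
    unfolding station_fn_def left_diff_distrib by (simp add: algebra_simps)
qed

section \<open>Coefficients and nonvanishing of the boundary polynomial\<close>

lemma boundary_poly_at_1: "poly boundary_poly 1 = 0"
  by (simp add: poly_boundary_poly)

text \<open>Below degree C only the monomials z^(C-u+j) contribute, and C - u + j = m means u = C -
  (m - j). The constraint j < u is then just m < C. Up to sign this is entry m of the row q
  Lambda.\<close>

lemma coeff_boundary_poly_less:
  assumes "m < C" shows "Polynomial.coeff boundary_poly m = - of_real (\<Sum>j\<le>m. q j * s (C - (m - j)))"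
proof -
  have "Polynomial.coeff boundary_poly m = (\<Sum>u\<le>C. \<Sum>j<u. if j + C = m + u then - of_real (s u * q j) else 0)"
    using assms unfolding boundary_poly_def
    by (auto simp: Polynomial.coeff_sum sum_distrib_left intro!: sum.cong)
  also have "\<dots> = (\<Sum>u\<le>C. \<Sum>j\<le>m. if u = C - (m - j) then - complex_of_real (s u * q j) else 0)"
    using assms by (intro sum.cong refl sum.mono_neutral_cong) auto
  also have "\<dots> = (\<Sum>j\<le>m. \<Sum>u\<le>C. if u = C - (m - j) then - complex_of_real (s u * q j) else 0)"
    by (rule sum.swap)
  also have "\<dots> = (\<Sum>j\<le>m. - complex_of_real (s (C - (m - j)) * q j))"
    by (intro sum.cong refl) (subst sum.delta, auto)
  finally show ?thesis by (simp add: sum_negf mult.commute)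
qed

lemma coeff_boundary_poly_real: "Polynomial.coeff boundary_poly m \<in> \<real>"
  unfolding boundary_poly_def
  by (auto simp: Polynomial.coeff_sum intro!: sum_in_Reals Reals_mult Reals_of_real Reals_diff)

lemma degree_boundary_poly: "Polynomial.degree boundary_poly \<le> C"
  unfolding boundary_poly_def
  by (intro degree_sum_le finite_atMost finite_lessThan order.trans[OF degree_smult_le] degree_diff_le
      order.trans[OF degree_monom_le]) auto

lemma G_0: "G 0 = of_real (p 0)"
  using G_sums[of 0] rho_gt_1 sums_unique2[OF powser_sums_zero[of "\<lambda>k. of_real (p k)"]] by auto

text \<open>Only u = C survives at 0, since 0^0 = 1. As \<open>p 0\<close> and \<open>s C\<close>
  are positive, 0 is not a root and F does not vanish identically.\<close>

lemma station_fn_0: "station_fn C s G 0 = - of_real (p 0 * s C)"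
proof -
  have "(\<Sum>u\<le>C. complex_of_real (s u) * 0 ^ (C - u)) = (\<Sum>u\<in>{C}. complex_of_real (s u) * 0 ^ (C - u))"
    by (rule sum.mono_neutral_right) auto
  then show ?thesis using C_ge_1 by (simp add: station_fn_def G_0)
qed

lemma holomorphic_G: "G holomorphic_on ball 0 \<rho>"
proof (rule power_series_holomorphic)
  show "(\<lambda>n. of_real (p n) * (w - 0) ^ n) sums G w" if "w \<in> ball 0 \<rho>" for w
    using that G_sums by simp
qed

lemma holomorphic_station_fn: "station_fn C s G holomorphic_on ball 0 \<rho>"
  unfolding station_fn_def by (intro holomorphic_intros holomorphic_G)

text \<open>If P were 0, then F A = 0 on the disk; F is nonzero near 0, so A would vanish there. A
  power series with some nonzero coefficient has no such accumulation of zeros.\<close>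

lemma boundary_poly_nz: "boundary_poly \<noteq> 0"
proof
  assume "boundary_poly = 0"
  have "\<exists>k. q k \<noteq> 0"
    using q_sums sums_unique2[of q 1 0] sums_0[of q] by fastforce
  then obtain k where k: "q k \<noteq> 0" by blast
  have "isCont (\<lambda>z. station_fn C s G z) 0"
    using holomorphic_station_fn rho_gt_1
    by (auto intro!: continuous_on_interior[of "ball 0 \<rho>"] holomorphic_on_imp_continuous_on)
  have nz: "station_fn C s G 0 \<noteq> 0" using station_fn_0 p_0_pos s_C_pos by simp
  obtain e where e: "e > 0" "\<And>z. dist 0 z < e \<Longrightarrow> station_fn C s G z \<noteq> 0"
    using continuous_at_avoid[OF \<open>isCont (\<lambda>z. station_fn C s G z) 0\<close> nz] by blast
  have "queue_pgf z = 0" if "norm z < min e 1" for z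
    using station_fn_mult_queue_pgf[of z] e(2)[of z] that \<open>boundary_poly = 0\<close> by simp
  note pgf_zero = this
  have "queue_pgf 0 = 0" using pgf_zero[of 0] e by simp
  moreover have "queue_pgf 0 = of_real (q 0)"
    using queue_pgf_sums[of 0] sums_unique2[OF powser_sums_zero[of "\<lambda>k. of_real (q k)"]] by auto
  ultimately have "k > 0" using k by (cases k) auto
  obtain r where r: "0 < r" "\<And>z. z \<in> cball 0 r - {0} \<Longrightarrow> queue_pgf z \<noteq> 0"
    by (rule powser_0_nonzero[of 1 0 "\<lambda>k. of_real (q k)" queue_pgf k])
       (use queue_pgf_sums \<open>queue_pgf 0 = 0\<close> \<open>k > 0\<close> k in auto)
  \<comment> \<open>A nonzero point lying in the unit disk, in the zero neighbourhood of A and in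
    the punctured disk without zeros.\<close>
  define x where "x = Min {r, e / 2, 1 / 2}"
  have "0 < x" "x \<le> r" "x < e" "x < 1" using r e by (auto simp: x_def)
  have "of_real x \<in> cball (0::complex) r - {0}" using \<open>0 < x\<close> \<open>x \<le> r\<close> by simp
  moreover have "queue_pgf (of_real x) = 0"
    using \<open>0 < x\<close> \<open>x < e\<close> \<open>x < 1\<close> by (intro pgf_zero) simp
  ultimately show False using r(2) by blast
qed

text \<open>A common zero of G and F satisfies w^C = 0, hence is 0, where F does not vanish.\<close>

lemma G_nonzero:
  assumes "norm w \<le> 1" "station_fn C s G w = 0" shows "G w \<noteq> 0"
proof
  assume "G w = 0"
  then have "w ^ C = 0" using assms by (simp add: station_fn_def)
  then have "w = 0" by simp
  then show False using assms station_fn_0 p_0_pos s_C_pos by simp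
qed

lemma isCont_G: "norm w \<le> 1 \<Longrightarrow> isCont G w"
  using holomorphic_G rho_gt_1
  by (auto intro!: continuous_on_interior[of "ball 0 \<rho>"] holomorphic_on_imp_continuous_on)

text \<open>
  The generating function of q need not be analytic across the unit circle, so the orders are
  compared along the open disk only; this treats roots inside and on the circle alike.
\<close>

lemma zorder_le_order_boundary_poly:
  assumes w: "norm w \<le> 1" and root: "station_fn C s G w = 0"
  shows "nat (zorder (station_fn C s G) w) \<le> Polynomial.order w boundary_poly"
proof -
  define n where "n = nat (zorder (station_fn C s G) w)"
  define g where "g = zor_poly (station_fn C s G) w"
  \<comment> \<open>F has finite order at \<open>w\<close> because it is not identically zero on the
    connected ball; the witness is 0.\<close>
  have "\<exists>x\<in>ball 0 \<rho>. station_fn C s G x \<noteq> 0"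
    using rho_gt_1 station_fn_0 p_0_pos s_C_pos by (intro bexI[of _ 0]) auto
  then obtain r where r: "r > 0" "g holomorphic_on cball w r"
      "\<And>x. x \<in> cball w r \<Longrightarrow> station_fn C s G x = g x * (x - w) ^ n"
    using zorder_exist_zero[OF holomorphic_station_fn open_ball connected_ball, of w] w rho_gt_1
    unfolding g_def n_def by (metis (no_types, lifting) le_less_trans mem_ball_0)
  have "isCont g w"
    using r by (auto intro!: continuous_on_interior[of "cball w r"] holomorphic_on_imp_continuous_on)
  have "isCont (\<lambda>x. g x / G x) w"
    by (intro isCont_divide \<open>isCont g w\<close> isCont_G w G_nonzero root)
  then have lim: "((\<lambda>x. norm (g x / G x)) \<longlongrightarrow> norm (g w / G w)) (at w within ball 0 1)"
    by (intro tendsto_norm) (auto simp: isCont_def intro: tendsto_within_subset)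
  have "((\<lambda>x. G x) \<longlongrightarrow> G w) (at w within ball 0 1)"
    using isCont_G[OF w] by (auto simp: isCont_def intro: tendsto_within_subset)
  then have "\<forall>\<^sub>F x in at w within ball 0 1. G x \<noteq> 0"
    using G_nonzero[OF w root] by (rule tendsto_imp_eventually_ne)
  moreover have "\<forall>\<^sub>F x in at w within ball 0 1. norm (g x / G x) < norm (g w / G w) + 1"
    by (rule order_tendstoD(2)[OF lim]) simp
  moreover have "\<forall>\<^sub>F x in at w within ball 0 1. x \<in> ball 0 1"
    by (simp add: eventually_at_filter)
  moreover have "\<forall>\<^sub>F x in at w within ball 0 1. x \<in> cball w r"
    using r by (auto simp: eventually_at dist_commute intro!: exI[of _ r])
  ultimately have "\<forall>\<^sub>F x in at w within ball 0 1.
      norm (poly boundary_poly x) \<le> (norm (g w / G w) + 1) * norm (x - w) ^ n"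
  proof eventually_elim
    case (elim x)
    have "norm x \<le> 1" using elim by simp
    \<comment> \<open>Solving F A = G P for P: the quotient g/G is bounded near \<open>w\<close> and
      |A| <= 1, so P inherits the power (x - w)^n.\<close>
    have "poly boundary_poly x = (g x / G x) * (x - w) ^ n * queue_pgf x"
      using station_fn_mult_queue_pgf[OF \<open>norm x \<le> 1\<close>] r(3)[of x] elim by (simp add: field_simps)
    then have "norm (poly boundary_poly x) = norm (g x / G x) * norm (x - w) ^ n * norm (queue_pgf x)"
      by (simp only: norm_mult norm_power)
    also have "\<dots> \<le> norm (g x / G x) * norm (x - w) ^ n"
      using norm_queue_pgf_le[OF \<open>norm x \<le> 1\<close>] by (intro mult_left_le) auto
    also have "\<dots> \<le> (norm (g w / G w) + 1) * norm (x - w) ^ n"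
      using elim by (intro mult_right_mono) auto
    finally show ?case .
  qed
  then show ?thesis unfolding n_def[symmetric]
    using w by (intro order_ge_if_norm_poly_le[OF boundary_poly_nz, of _ "ball 0 1"])
      (auto simp: islimpt_ball)
qed

text \<open>With multisets, the comparison of multiplicities becomes an inclusion of the listed
  roots in \<open>proots\<close>; sizes C and at most C force equality.\<close>

lemma boundary_poly_eq_prod:
  assumes roots: "lists_unit_disk_roots (station_fn C s G) C z"
  shows "boundary_poly = Polynomial.smult (- of_real (s C * q 0)) (\<Prod>i<C. [:1, - 1 / z i:])"
    and "\<And>i. i < C \<Longrightarrow> z i \<noteq> 0"
proof -
  have nz: "z i \<noteq> 0" if "i < C" for i
    using roots that station_fn_0 p_0_pos s_C_pos by (auto simp: lists_unit_disk_roots_def)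
  show "\<And>i. i < C \<Longrightarrow> z i \<noteq> 0" by fact
  define Z where "Z = image_mset z (mset_set {..<C})"
  have "Z \<subseteq># proots boundary_poly"
  proof (rule mset_subset_eqI)
    fix w
    have count: "count Z w = card {i. i < C \<and> z i = w}"
      by (simp add: Z_def count_image_mset vimage_def Int_def conj_commute)
    show "count Z w \<le> count (proots boundary_poly) w"
    proof (cases "\<exists>i<C. z i = w")
      case True
      then have "norm w \<le> 1" "station_fn C s G w = 0"
        using roots by (auto simp: lists_unit_disk_roots_def)
      then show ?thesis
        using roots zorder_le_order_boundary_poly[of w] boundary_poly_nz
        by (auto simp: lists_unit_disk_roots_def count simp flip: nat_int)
    next
      case False
      then have "{i. i < C \<and> z i = w} = {}" by blast
      then show ?thesis by (simp only: count card.empty zero_le)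
    qed
  qed
  moreover have "\<not> size Z < size (proots boundary_poly)"
    using size_proots_le[of boundary_poly] degree_boundary_poly by (simp add: Z_def)
  ultimately have "proots boundary_poly = Z"
    using mset_subset_size[of Z "proots boundary_poly"] by (auto simp: subset_mset.le_less)
  then have "boundary_poly = Polynomial.smult (Polynomial.lead_coeff boundary_poly) (\<Prod>x\<in>#Z. [:-x, 1:])"
    using complex_poly_decompose_multiset[of boundary_poly] by simp
  also have "(\<Prod>x\<in>#Z. [:-x, 1:]) = (\<Prod>i<C. [:- z i, 1:])"
    by (simp add: Z_def prod_unfold_prod_mset image_mset.compositionality o_def)
  \<comment> \<open>z - z_i = (-z_i) (1 - z/z_i), which relies on z_i being nonzero.\<close>
  also have "\<dots> = (\<Prod>i<C. Polynomial.smult (- z i) [:1, - 1 / z i:])"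
    using nz by (intro prod.cong) auto
  also have "\<dots> = Polynomial.smult (\<Prod>i<C. - z i) (\<Prod>i<C. [:1, - 1 / z i:])"
    by (rule prod_smult)
  finally have "boundary_poly = Polynomial.smult (Polynomial.lead_coeff boundary_poly * (\<Prod>i<C. - z i)) (\<Prod>i<C. [:1, - 1 / z i:])"
    unfolding smult_smult .
  then obtain c where c: "boundary_poly = Polynomial.smult c (\<Prod>i<C. [:1, - 1 / z i:])" by blast
  \<comment> \<open>Every factor 1 - z/z_i equals 1 at 0, so the constant is the coefficient of
    degree 0.\<close>
  have "c = poly boundary_poly 0" unfolding c by (simp add: poly_prod)
  also have "\<dots> = - of_real (s C * q 0)"
    using coeff_boundary_poly_less[of 0] C_ge_1 by (simp add: poly_0_coeff_0 mult.commute)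
  finally show "boundary_poly = Polynomial.smult (- of_real (s C * q 0)) (\<Prod>i<C. [:1, - 1 / z i:])"
    using c by simp
qed

section \<open>The derivative at 1 and the formula for q_0\<close>

lemma pderiv_boundary_poly_at_1:
  "poly (pderiv boundary_poly) 1 = of_real (\<Sum>u\<le>C. s u * (\<Sum>j<u. q j * (real u - real j)))"
proof -
  have "poly (pderiv boundary_poly) 1 = (\<Sum>u\<le>C. of_real (s u) * (\<Sum>j<u. of_real (q j) *
      (of_nat C - of_nat (C - u + j))))"
    by (simp add: boundary_poly_def higher_pderiv_sum[of "Suc 0", simplified] pderiv_smult pderiv_diff pderiv_monom poly_sum poly_monom)
  also have "\<dots> = (\<Sum>u\<le>C. of_real (s u) * (\<Sum>j<u. of_real (q j) * (of_nat u - of_nat j)))"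
    by (intro sum.cong refl arg_cong2[where f = "(*)"]) (auto simp: of_nat_diff)
  finally show ?thesis by simp
qed

text \<open>All summands are nonnegative; the one with u = C carries the positive weight
  \<open>s C\<close> and involves every q_j with j < C.\<close>

lemma pderiv_boundary_poly_at_1_nz: "poly (pderiv boundary_poly) 1 \<noteq> 0"
proof
  assume "poly (pderiv boundary_poly) 1 = 0"
  then have 0: "(\<Sum>u\<le>C. s u * (\<Sum>j<u. q j * (real u - real j))) = 0"
    unfolding pderiv_boundary_poly_at_1 by (simp only: of_real_eq_0_iff)
  have "\<forall>u\<in>{..C}. s u * (\<Sum>j<u. q j * (real u - real j)) = 0"
    by (rule sum_nonneg_eq_0_iff[THEN iffD1, OF _ _ 0])
       (auto intro!: mult_nonneg_nonneg sum_nonneg s_nonneg q_nonneg)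
  then have "s C * (\<Sum>j<C. q j * (real C - real j)) = 0" by blast
  then have 1: "(\<Sum>j<C. q j * (real C - real j)) = 0" using s_C_pos by simp
  have "\<forall>j\<in>{..<C}. q j * (real C - real j) = 0"
    by (rule sum_nonneg_eq_0_iff[THEN iffD1, OF _ _ 1])
       (auto intro!: mult_nonneg_nonneg q_nonneg)
  then have "q j = 0" if "j < C" for j using that by auto
  then have "boundary_poly = 0" by (auto simp: boundary_poly_def)
  then show False using boundary_poly_nz by simp
qed

lemma G_1: "G 1 = 1"
proof -
  have "(\<lambda>k. complex_of_real (p k)) sums of_real 1"
    using p_sums by (simp only: sums_of_real_iff)
  then show ?thesis using G_sums[of 1] rho_gt_1 sums_unique2 by fastforce
qed

lemma DERIV_G_1:
  assumes "(\<lambda>k. real k * p k) sums m"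
  shows "(G has_field_derivative of_real m) (at 1)"
proof -
  have "((\<lambda>z. \<Sum>k. complex_of_real (p k) * z ^ k) has_field_derivative
      (\<Sum>k. diffs (\<lambda>k. complex_of_real (p k)) k * 1 ^ k)) (at 1)"
    by (rule termdiffs_strong'[of \<rho>]) (use G_sums rho_gt_1 in \<open>auto simp: sums_iff\<close>)
  moreover have "(\<Sum>k. diffs (\<lambda>k. complex_of_real (p k)) k * 1 ^ k) = of_real m"
  proof -
    have "(\<lambda>k. real (Suc k) * p (Suc k)) sums m"
      using assms by (subst sums_Suc_iff) simp
    then have "(\<lambda>k. complex_of_real (real (Suc k) * p (Suc k))) sums of_real m"
      by (simp only: sums_of_real_iff)
    then show ?thesis by (simp add: diffs_def sums_iff)
  qed
  ultimately have "((\<lambda>z. \<Sum>k. complex_of_real (p k) * z ^ k) has_field_derivative of_real m) (at 1)"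
    by simp
  then show ?thesis
    by (rule has_field_derivative_transform_within_open[of _ _ _ "ball 0 \<rho>"])
       (use G_sums rho_gt_1 in \<open>auto simp: sums_iff\<close>)
qed

text \<open>The product rule for F A would require a derivative of A at 1. Instead F A = G P is
  divided by x - 1: since F and P vanish at 1, both quotients tend to derivatives, and continuity of
  A within the closed disk suffices.\<close>

lemma pderiv_boundary_poly_at_1_eq_drift:
  assumes m: "(\<lambda>k. real k * p k) sums m"
  shows "poly (pderiv boundary_poly) 1 = of_real ((\<Sum>u\<le>C. real u * s u) - m)"
proof -
  define F where "F = station_fn C s G"
  have F1: "F 1 = 0"
    using s_sum by (simp add: F_def station_fn_def G_1 flip: of_real_sum)
  have "(F has_field_derivative
      (of_nat C * 1 - (of_real m * (\<Sum>u\<le>C. of_real (s u) * 1 ^ (C - u))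
        + (\<Sum>u\<le>C. of_real (s u) * of_nat (C - u)) * G 1))) (at 1)"
    unfolding F_def station_fn_def
    by (auto intro!: derivative_eq_intros DERIV_G_1[OF m] sum.cong)
  also have "(of_nat C * 1 - (of_real m * (\<Sum>u\<le>C. of_real (s u) * 1 ^ (C - u))
        + (\<Sum>u\<le>C. of_real (s u) * of_nat (C - u)) * G 1))
      = complex_of_real ((\<Sum>u\<le>C. real u * s u) - m)"
  proof -
    have "(\<Sum>u\<le>C. s u * real (C - u)) = (\<Sum>u\<le>C. s u * real C - real u * s u)"
      by (intro sum.cong) (auto simp: of_nat_diff algebra_simps)
    also have "\<dots> = real C - (\<Sum>u\<le>C. real u * s u)"
      using s_sum by (simp add: sum_subtractf flip: sum_distrib_right)
    finally have "(\<Sum>u\<le>C. complex_of_real (s u) * of_nat (C - u)) = of_real (real C - (\<Sum>u\<le>C. real u * s u))"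
      by (metis (mono_tags, lifting) of_real_mult of_real_of_nat_eq of_real_sum sum.cong)
    then show ?thesis
      using s_sum by (simp add: G_1 flip: of_real_sum)
  qed
  finally have "((\<lambda>x. (F x - F 1) / (x - 1)) \<longlongrightarrow> of_real ((\<Sum>u\<le>C. real u * s u) - m)) (at 1)"
    by (simp add: has_field_derivative_iff)
  then have "((\<lambda>x. F x / (x - 1)) \<longlongrightarrow> of_real ((\<Sum>u\<le>C. real u * s u) - m)) (at 1 within cball 0 1)"
    by (auto simp: F1 intro: tendsto_within_subset)
  moreover have "(queue_pgf \<longlongrightarrow> queue_pgf 1) (at 1 within cball 0 1)"
    using continuous_on_queue_pgf by (auto simp: continuous_on_def)
  ultimately have 1: "((\<lambda>x. F x / (x - 1) * queue_pgf x) \<longlongrightarrow> of_real ((\<Sum>u\<le>C. real u * s u) - m) * 1)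
      (at 1 within cball 0 1)"
    unfolding queue_pgf_1 by (rule tendsto_mult)
  have "((\<lambda>x. (poly boundary_poly x - poly boundary_poly 1) / (x - 1)) \<longlongrightarrow> poly (pderiv boundary_poly) 1) (at 1)"
    using poly_DERIV[of boundary_poly 1] by (simp add: has_field_derivative_iff)
  then have "((\<lambda>x. poly boundary_poly x / (x - 1)) \<longlongrightarrow> poly (pderiv boundary_poly) 1) (at 1 within cball 0 1)"
    by (auto simp: boundary_poly_at_1 intro: tendsto_within_subset)
  moreover have "(G \<longlongrightarrow> 1) (at 1 within cball 0 1)"
    using isCont_G[of 1] by (auto simp: isCont_def G_1 intro: tendsto_within_subset)
  ultimately have "((\<lambda>x. G x * (poly boundary_poly x / (x - 1))) \<longlongrightarrow> 1 * poly (pderiv boundary_poly) 1) (at 1 within cball 0 1)"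
    by (intro tendsto_mult)
  then have "((\<lambda>x. F x / (x - 1) * queue_pgf x) \<longlongrightarrow> 1 * poly (pderiv boundary_poly) 1) (at 1 within cball 0 1)"
  proof (rule Lim_transform_eventually)
    show "\<forall>\<^sub>F x in at 1 within cball 0 1. G x * (poly boundary_poly x / (x - 1)) = F x / (x - 1) * queue_pgf x"
      using station_fn_mult_queue_pgf by (auto simp: eventually_at_filter F_def)
  qed
  note 2 = this
  have nontriv: "at (1::complex) within cball 0 1 \<noteq> bot"
    unfolding trivial_limit_within
    by (simp add: islimpt_subset[OF _ ball_subset_cball] islimpt_ball)
  show ?thesis using tendsto_unique[OF nontriv 2 1] by simp
qed

lemma q_0_eq:
  assumes roots: "lists_unit_disk_roots (station_fn C s G) C z" and "z 0 = 1"
    and m: "(\<lambda>k. real k * p k) sums m"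
  shows "complex_of_real (q 0) =
    of_real (1 / s C * ((\<Sum>u\<le>C. real u * s u) - m)) * (\<Prod>i=1..<C. z i / (z i - 1))"
proof -
  define D where "D = (\<Sum>u\<le>C. real u * s u) - m"
  define R where "R = (\<Prod>i=1..<C. [:1, - 1 / z i:])"
  note [simp] = boundary_poly_eq_prod(2)[OF roots]
  have "{..<C} = insert 0 {1..<C}" using C_ge_1 by auto
  then have "boundary_poly = Polynomial.smult (- of_real (s C * q 0)) ([:1, -1:] * R)"
    using boundary_poly_eq_prod(1)[OF roots] \<open>z 0 = 1\<close> by (simp add: R_def)
  then have "pderiv boundary_poly = Polynomial.smult (- of_real (s C * q 0)) ([:1, -1:] * pderiv R + R * [:-1:])"
    by (simp only: pderiv_smult pderiv_mult) (simp add: pderiv_pCons)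
  \<comment> \<open>At 1 the factor 1 - z removes \<open>pderiv R\<close>, and the two minus signs
    cancel.\<close>
  then have "poly (pderiv boundary_poly) 1 = of_real (s C * q 0) * poly R 1"
    by simp
  then have eq: "of_real (s C * q 0) * (\<Prod>i=1..<C. 1 - 1 / z i) = of_real D"
    using pderiv_boundary_poly_at_1_eq_drift[OF m] by (simp add: D_def R_def poly_prod)
  \<comment> \<open>A nonzero drift keeps each 1 - 1/z_i away from 0, so the quotients z_i / (z_i -
    1) are true inverses and not division by zero.\<close>
  moreover have "complex_of_real D \<noteq> 0"
    using pderiv_boundary_poly_at_1_nz pderiv_boundary_poly_at_1_eq_drift[OF m] by (simp add: D_def)
  ultimately have "(\<Prod>i=1..<C. 1 - 1 / z i) \<noteq> 0" by (metis mult_zero_right)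
  then have nz: "1 - 1 / z i \<noteq> 0" if "i \<in> {1..<C}" for i using that by (metis finite_atLeastLessThan prod_zero_iff)
  have "(\<Prod>i=1..<C. z i / (z i - 1)) * (\<Prod>i=1..<C. 1 - 1 / z i)
      = (\<Prod>i=1..<C. z i / (z i - 1) * (1 - 1 / z i))"
    by (rule prod.distrib[symmetric])
  also have "\<dots> = 1"
    using nz by (intro prod.neutral ballI) (auto simp: field_simps)
  finally have inv: "(\<Prod>i=1..<C. z i / (z i - 1)) * (\<Prod>i=1..<C. 1 - 1 / z i) = 1" .
  have "of_real D * (\<Prod>i=1..<C. z i / (z i - 1))
      = of_real (s C * q 0) * ((\<Prod>i=1..<C. z i / (z i - 1)) * (\<Prod>i=1..<C. 1 - 1 / z i))"
    unfolding eq[symmetric] by (simp only: mult_ac)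
  then have "of_real (s C * q 0) = of_real D * (\<Prod>i=1..<C. z i / (z i - 1))"
    unfolding inv by simp
  then show ?thesis
    using s_C_pos by (simp add: D_def field_simps)
qed

section \<open>Real coefficients and the linear system\<close>

lemma q_0_nz:
  assumes "lists_unit_disk_roots (station_fn C s G) C z"
  shows "q 0 \<noteq> 0"
  using boundary_poly_eq_prod(1)[OF assms] boundary_poly_nz by auto

lemma coeff_boundary_poly_eq_eta:
  assumes "lists_unit_disk_roots (station_fn C s G) C z"
  shows "Polynomial.coeff boundary_poly j = - of_real (s C * q 0) * eta C z j"
  by (subst boundary_poly_eq_prod(1)[OF assms]) (simp add: eta_def)

text \<open>Reality is read off from P, whose coefficients are real and differ from
  \<open>eta\<close> by the nonzero real factor -s_C q_0, rather than from conjugate pairs of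
  roots.\<close>

lemma eta_real:
  assumes "lists_unit_disk_roots (station_fn C s G) C z"
  shows "eta C z j \<in> \<real>"
proof -
  have "eta C z j = - Polynomial.coeff boundary_poly j / of_real (s C * q 0)"
    using coeff_boundary_poly_eq_eta[OF assms, of j] q_0_nz[OF assms] s_C_pos by (simp add: field_simps)
  then show ?thesis by (simp only: Reals_divide Reals_minus coeff_boundary_poly_real Reals_of_real)
qed

lemma Re_eta_tilde:
  assumes roots: "lists_unit_disk_roots (station_fn C s G) C z" and "j < C"
  shows "(\<Sum>i\<le>j. q i * s (C - (j - i))) = Re (of_real (s C) * of_real (q 0) * eta C z j)"
  using coeff_boundary_poly_less[OF \<open>j < C\<close>] coeff_boundary_poly_eq_eta[OF roots, of j]
  by (metis (no_types, lifting) Re_complex_of_real minus_mult_left neg_equal_iff_equal of_real_mult)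

end

section \<open>The matrix Lambda\<close>

lemma Lambda_mat_carrier [simp]: "Lambda_mat C s \<in> carrier_mat C C"
  by (simp add: Lambda_mat_def)

lemma det_Lambda_mat: "Determinant.det (Lambda_mat C s) = s C ^ C"
proof -
  have "upper_triangular (Lambda_mat C s)"
    by (auto simp: upper_triangular_def Lambda_mat_def)
  then have "Determinant.det (Lambda_mat C s) = prod_list (diag_mat (Lambda_mat C s))"
    by (rule det_upper_triangular[OF _ Lambda_mat_carrier])
  also have "diag_mat (Lambda_mat C s) = replicate C (s C)"
    by (auto simp: diag_mat_def Lambda_mat_def intro!: nth_equalityI)
  finally show ?thesis by simp
qed

text \<open>The determinant s_C^C rules out the outcome \<open>None\<close>.\<close>

lemma mat_inverse_Lambda_mat:
  assumes "s C \<noteq> 0"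
  obtains B where "mat_inverse (Lambda_mat C s) = Some B" "B \<in> carrier_mat C C"
    "Lambda_mat C s * B = 1\<^sub>m C" "B * Lambda_mat C s = 1\<^sub>m C"
proof (cases "mat_inverse (Lambda_mat C s)")
  case None
  have "Determinant.det (Lambda_mat C s) \<noteq> 0" using assms by (simp add: det_Lambda_mat)
  then have "Lambda_mat C s \<in> Units (ring_mat TYPE(real) C b)"
    by (rule det_non_zero_imp_unit[OF Lambda_mat_carrier])
  then show ?thesis using mat_inverse(1)[OF Lambda_mat_carrier None, of b] by blast
next
  case (Some B)
  then show ?thesis using mat_inverse(2)[OF Lambda_mat_carrier Some] that by blast
qed

lemma invertible_Lambda_mat:
  assumes "s C \<noteq> 0" shows "invertible_mat (Lambda_mat C s)"
proof -
  obtain B where "B \<in> carrier_mat C C" "Lambda_mat C s * B = 1\<^sub>m C" "B * Lambda_mat C s = 1\<^sub>m C"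
    using mat_inverse_Lambda_mat[of s C, OF assms] by metis
  then show ?thesis
    using Lambda_mat_carrier[of C s] unfolding invertible_mat_def inverts_mat_def
    by (metis carrier_matD square_mat.simps)
qed

lemma mat_of_row_eq_mult_inverse:
  assumes "s C \<noteq> 0" and w: "\<And>j. j < C \<Longrightarrow> (\<Sum>i\<le>j. v i * s (C - (j - i))) = w j"
  shows "mat_of_row (Matrix.vec C v) = mat_of_row (Matrix.vec C w) * the (mat_inverse (Lambda_mat C s))"
proof -
  obtain B where B: "mat_inverse (Lambda_mat C s) = Some B" "B \<in> carrier_mat C C"
    "Lambda_mat C s * B = 1\<^sub>m C"
    using mat_inverse_Lambda_mat[of s C, OF assms(1)] by metis
  have v: "mat_of_row (Matrix.vec C v) \<in> carrier_mat 1 C" by (simp add: mat_of_row_def)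
  have "mat_of_row (Matrix.vec C v) * Lambda_mat C s = mat_of_row (Matrix.vec C w)"
  proof (rule eq_matI)
    fix i j assume "i < dim_row (mat_of_row (Matrix.vec C w))" "j < dim_col (mat_of_row (Matrix.vec C w))"
    then have ij: "i = 0" "j < C" by (auto simp: mat_of_row_def)
    have "(mat_of_row (Matrix.vec C v) * Lambda_mat C s) $$ (i, j)
        = (\<Sum>k\<in>{0..<C}. v k * (if k \<le> j then s (C - (j - k)) else 0))"
      using ij by (simp add: mat_of_row_def Lambda_mat_def scalar_prod_def)
    also have "\<dots> = (\<Sum>k\<le>j. v k * s (C - (j - k)))"
      using ij by (intro sum.mono_neutral_cong_right) auto
    finally show "(mat_of_row (Matrix.vec C v) * Lambda_mat C s) $$ (i, j) = mat_of_row (Matrix.vec C w) $$ (i, j)"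
      using ij w by (simp add: mat_of_row_def)
  qed (auto simp: mat_of_row_def Lambda_mat_def)
  then have "mat_of_row (Matrix.vec C w) * B = mat_of_row (Matrix.vec C v) * (Lambda_mat C s * B)"
    using assoc_mult_mat[OF v Lambda_mat_carrier[of C s] B(2)] by simp
  then show ?thesis using B v by simp
qed

section \<open>Exponential moments of the headway laws\<close>

text \<open>The convention 0^0 = 1 lets the formula include the degenerate rate 0.\<close>

lemma pmf_poisson_law:
  assumes "0 \<le> r" shows "pmf (poisson_law r) k = r ^ k / fact k * exp (- r)"
proof (cases "r = 0")
  case True
  then show ?thesis by (cases k) (auto simp: poisson_law_def)
next
  case False
  then show ?thesis using assms by (simp add: poisson_law_def)
qed

lemma suminf_pmf_poisson_law_power:
  assumes "0 \<le> r" "0 \<le> a"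
  shows "(\<Sum>k. ennreal (pmf (poisson_law r) k * a ^ k)) = ennreal (exp (r * (a - 1)))"
proof -
  have "(\<lambda>k. (r * a) ^ k /\<^sub>R fact k * exp (- r)) sums (exp (r * a) * exp (- r))"
    by (intro sums_mult2 exp_converges)
  also have "(\<lambda>k. (r * a) ^ k /\<^sub>R fact k * exp (- r)) = (\<lambda>k. pmf (poisson_law r) k * a ^ k)"
    using assms by (simp add: pmf_poisson_law power_mult_distrib field_simps)
  also have "exp (r * a) * exp (- r) = exp (r * (a - 1))"
    by (simp add: algebra_simps flip: exp_add)
  finally have sums: "(\<lambda>k. pmf (poisson_law r) k * a ^ k) sums exp (r * (a - 1))" .
  have "(\<Sum>k. ennreal (pmf (poisson_law r) k * a ^ k)) = ennreal (\<Sum>k. pmf (poisson_law r) k * a ^ k)"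
    using assms sums_summable[OF sums] by (intro suminf_ennreal2) auto
  then show ?thesis using sums_unique[OF sums] by simp
qed

lemma nn_integral_poisson_law_power:
  assumes "0 \<le> r" "0 \<le> a"
  shows "(\<integral>\<^sup>+k. ennreal (a ^ k) \<partial>measure_pmf (poisson_law r)) = ennreal (exp (r * (a - 1)))"
  unfolding nn_integral_measure_pmf nn_integral_count_space_nat
    suminf_pmf_poisson_law_power[OF assms, symmetric]
  using assms(2) by (intro suminf_cong) (simp add: ennreal_mult)

text \<open>Tilting an exponential density by exp(tau x) gives a multiple of the density with rate
  \<open>\<theta>\<close> - \<open>\<tau>\<close>. Negative \<open>\<tau>\<close> is allowed, as the
  subtracted sum in the headway needs it.\<close>

lemma nn_integral_exp_exponential_density:
  assumes "0 < \<theta>" "\<tau> < \<theta>"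
  shows "(\<integral>\<^sup>+x. ennreal (exp (\<tau> * x)) \<partial>density lborel (exponential_density \<theta>)) = ennreal (\<theta> / (\<theta> - \<tau>))"
proof -
  have "(\<integral>\<^sup>+x. ennreal (exp (\<tau> * x)) \<partial>density lborel (exponential_density \<theta>))
      = (\<integral>\<^sup>+x. ennreal (exponential_density \<theta> x) * ennreal (exp (\<tau> * x)) \<partial>lborel)"
    by (rule nn_integral_density) auto
  also have "\<dots> = (\<integral>\<^sup>+x. ennreal (\<theta> / (\<theta> - \<tau>)) * ennreal (exponential_density (\<theta> - \<tau>) x) \<partial>lborel)"
    using assms
    by (intro nn_integral_cong, simp flip: ennreal_mult' ennreal_mult'')
       (auto simp: exponential_density_def field_simps simp flip: exp_add)
  also have "\<dots> = ennreal (\<theta> / (\<theta> - \<tau>)) * (\<integral>\<^sup>+x. ennreal (exponential_density (\<theta> - \<tau>) x) \<partial>lborel)"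
    by (rule nn_integral_cmult) auto
  also have "(\<integral>\<^sup>+x. ennreal (exponential_density (\<theta> - \<tau>) x) \<partial>lborel) = 1"
    using prob_space.emeasure_space_1[OF prob_space_exponential_density[of "\<theta> - \<tau>"]] assms
    by (simp add: emeasure_density)
  finally show ?thesis by simp
qed

lemma measurable_poisson_exp_sum [measurable]:
  "(\<lambda>(k, e). \<Sum>i<k. e i) \<in> borel_measurable (measure_pmf p \<Otimes>\<^sub>M
      (\<Pi>\<^sub>M i\<in>(UNIV :: nat set). density lborel (exponential_density \<theta>)))"
proof -
  have "(\<lambda>x. (\<lambda>k x. \<Sum>i<k. snd x i) (fst x) x) \<in> borel_measurable (measure_pmf p \<Otimes>\<^sub>M
      (\<Pi>\<^sub>M i\<in>(UNIV :: nat set). density lborel (exponential_density \<theta>)))"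
    by (rule measurable_compose_countable) measurable
  then show ?thesis by (simp add: case_prod_unfold)
qed

lemma product_prob_space_exponential:
  assumes "0 < \<theta>"
  shows "product_prob_space (\<lambda>_ :: nat. density lborel (exponential_density \<theta>))"
  by (intro product_prob_spaceI prob_space_exponential_density assms)

lemma prob_space_poisson_exp_sum_law:
  assumes "0 < \<theta>" shows "prob_space (poisson_exp_sum_law r \<theta>)"
proof -
  interpret E: prob_space "\<Pi>\<^sub>M i\<in>(UNIV :: nat set). density lborel (exponential_density \<theta>)"
    by (intro prob_space_PiM prob_space_exponential_density assms)
  interpret P: pair_prob_space "measure_pmf (poisson_law r)"
    "\<Pi>\<^sub>M i\<in>(UNIV :: nat set). density lborel (exponential_density \<theta>)" ..
  show ?thesis unfolding poisson_exp_sum_law_def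
    by (rule P.prob_space_distr) measurable
qed

text \<open>With \<open>a\<close> the exponential moment of one summand, E exp(tau I) = E a^K is a
  value of the Poisson generating function. The inner integral sees only the first k coordinates, so
  restricting to a finite product makes the product rule available.\<close>

lemma nn_integral_exp_poisson_exp_sum_law:
  assumes "0 < \<theta>" "\<tau> < \<theta>" "0 \<le> r"
  shows "(\<integral>\<^sup>+x. ennreal (exp (\<tau> * x)) \<partial>poisson_exp_sum_law r \<theta>) < \<infinity>"
proof -
  let ?E = "\<lambda>_ :: nat. density lborel (exponential_density \<theta>)"
  define a where "a = \<theta> / (\<theta> - \<tau>)"
  have "0 \<le> a" using assms by (simp add: a_def)
  interpret E: product_prob_space ?E UNIV
    by (rule product_prob_space_exponential[OF assms(1)])
  have inner: "(\<integral>\<^sup>+e. ennreal (exp (\<tau> * (\<Sum>i<k. e i))) \<partial>PiM UNIV ?E) = ennreal (a ^ k)" for k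
  proof -
    have "(\<integral>\<^sup>+e. ennreal (exp (\<tau> * (\<Sum>i<k. e i))) \<partial>PiM UNIV ?E)
        = (\<integral>\<^sup>+e. (\<Prod>i<k. ennreal (exp (\<tau> * restrict e {..<k} i))) \<partial>PiM UNIV ?E)"
      by (intro nn_integral_cong) (simp add: sum_distrib_left exp_sum prod_ennreal)
    also have "\<dots> = (\<integral>\<^sup>+e. (\<Prod>i<k. ennreal (exp (\<tau> * e i))) \<partial>distr (PiM UNIV ?E) (PiM {..<k} ?E) (\<lambda>x. restrict x {..<k}))"
      by (rule nn_integral_distr[symmetric], rule measurable_restrict_subset, simp, measurable)
    also have "\<dots> = (\<integral>\<^sup>+e. (\<Prod>i<k. ennreal (exp (\<tau> * e i))) \<partial>PiM {..<k} ?E)"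
      by (subst E.distr_PiM_restrict_finite) auto
    also have "\<dots> = (\<Prod>i<k. \<integral>\<^sup>+x. ennreal (exp (\<tau> * x)) \<partial>?E i)"
      by (rule E.product_nn_integral_prod) auto
    also have "\<dots> = ennreal (a ^ k)"
      using \<open>0 \<le> a\<close> by (simp add: nn_integral_exp_exponential_density[OF assms(1,2)] a_def ennreal_power)
    finally show ?thesis .
  qed
  have "(\<integral>\<^sup>+x. ennreal (exp (\<tau> * x)) \<partial>poisson_exp_sum_law r \<theta>)
      = (\<integral>\<^sup>+x. ennreal (exp (\<tau> * (\<Sum>i<fst x. snd x i))) \<partial>(measure_pmf (poisson_law r) \<Otimes>\<^sub>M PiM UNIV ?E))"
    unfolding poisson_exp_sum_law_def
    by (subst nn_integral_distr) (measurable, simp add: case_prod_unfold)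
  also have "\<dots> = (\<integral>\<^sup>+k. \<integral>\<^sup>+e. ennreal (exp (\<tau> * (\<Sum>i<k. e i))) \<partial>PiM UNIV ?E \<partial>measure_pmf (poisson_law r))"
  proof (subst E.P.nn_integral_fst[symmetric])
    show "(\<lambda>x. ennreal (exp (\<tau> * (\<Sum>i<fst x. snd x i))))
        \<in> borel_measurable (measure_pmf (poisson_law r) \<Otimes>\<^sub>M PiM UNIV ?E)"
      using measurable_poisson_exp_sum[of "poisson_law r" \<theta>] by (simp add: case_prod_unfold)
  qed simp
  also have "\<dots> < \<infinity>"
    using nn_integral_poisson_law_power[OF assms(3) \<open>0 \<le> a\<close>] by (simp add: inner)
  finally show ?thesis .
qed

lemma prob_space_raw_headway_law:
  assumes "0 < \<theta>" shows "prob_space (raw_headway_law \<gamma> \<theta> Hbar Fbar Tn TN)"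
proof -
  interpret I: prob_space "poisson_exp_sum_law (\<gamma> * Tn) \<theta>"
    by (rule prob_space_poisson_exp_sum_law[OF assms])
  interpret P: pair_prob_space "poisson_exp_sum_law (\<gamma> * Tn) \<theta>" "poisson_exp_sum_law (\<gamma> * Tn) \<theta>" ..
  have [measurable_cong]: "sets (poisson_exp_sum_law (\<gamma> * Tn) \<theta>) = sets borel"
    by (simp add: poisson_exp_sum_law_def)
  show ?thesis unfolding raw_headway_law_def
    by (rule P.prob_space_distr) measurable
qed

lemma nn_integral_exp_raw_headway_law:
  assumes "0 < \<theta>" "0 \<le> t" "t < \<theta>" "0 \<le> \<gamma> * Tn"
  shows "(\<integral>\<^sup>+x. ennreal (exp (t * x)) \<partial>raw_headway_law \<gamma> \<theta> Hbar Fbar Tn TN) < \<infinity>"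
proof -
  let ?L = "poisson_exp_sum_law (\<gamma> * Tn) \<theta>"
  define c where "c = Hbar + 2 * \<gamma> * TN / (\<theta> * Fbar)"
  interpret I: prob_space ?L
    by (rule prob_space_poisson_exp_sum_law[OF assms(1)])
  have [measurable_cong]: "sets ?L = sets borel"
    by (simp add: poisson_exp_sum_law_def)
  have "(\<integral>\<^sup>+x. ennreal (exp (t * x)) \<partial>raw_headway_law \<gamma> \<theta> Hbar Fbar Tn TN)
      = (\<integral>\<^sup>+x. ennreal (exp (t * (c + fst x - snd x))) \<partial>(?L \<Otimes>\<^sub>M ?L))"
    unfolding raw_headway_law_def c_def
    by (subst nn_integral_distr) (measurable, simp add: case_prod_unfold)
  also have "\<dots> = (\<integral>\<^sup>+x. \<integral>\<^sup>+y. ennreal (exp (t * (c + x - y))) \<partial>?L \<partial>?L)"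
    by (subst I.nn_integral_fst[symmetric]) auto
  also have "\<dots> = (\<integral>\<^sup>+x. \<integral>\<^sup>+y. ennreal (exp (t * c)) * ennreal (exp (t * x)) * ennreal (exp ((- t) * y)) \<partial>?L \<partial>?L)"
    by (intro nn_integral_cong) (simp add: algebra_simps flip: ennreal_mult exp_add)
  also have "\<dots> = ennreal (exp (t * c)) * (\<integral>\<^sup>+x. ennreal (exp (t * x)) \<partial>?L) * (\<integral>\<^sup>+y. ennreal (exp ((- t) * y)) \<partial>?L)"
    by (simp add: nn_integral_cmult nn_integral_multc)
  also have "\<dots> < \<infinity>"
    using nn_integral_exp_poisson_exp_sum_law[of \<theta> t "\<gamma> * Tn"]
      nn_integral_exp_poisson_exp_sum_law[of \<theta> "- t" "\<gamma> * Tn"] assms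
    by (auto simp: ennreal_mult_less_top)
  finally show ?thesis .
qed

lemma prob_space_normal_law:
  assumes "0 \<le> v" shows "prob_space (normal_law m v)"
  using assms by (auto simp: normal_law_def intro!: prob_space_return prob_space_normal_density)

text \<open>Completing the square: tilting shifts the mean by t sigma^2 and leaves the factor
  \<open>c\<close>, the moment generating function at t.\<close>

lemma nn_integral_exp_normal_law:
  assumes "0 \<le> v"
  shows "(\<integral>\<^sup>+x. ennreal (exp (t * x)) \<partial>normal_law m v) < \<infinity>"
proof (cases "v = 0")
  case True
  then show ?thesis by (simp add: normal_law_def nn_integral_return)
next
  case False
  define \<sigma> where "\<sigma> = sqrt v"
  have "0 < \<sigma>" using False assms by (simp add: \<sigma>_def)
  define c where "c = exp (t * m + t\<^sup>2 * \<sigma>\<^sup>2 / 2)"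
  have shift: "normal_density m \<sigma> x * exp (t * x) = c * normal_density (m + t * \<sigma>\<^sup>2) \<sigma> x" for x
  proof -
    have "- (x - m)\<^sup>2 / (2 * \<sigma>\<^sup>2) + t * x = t * m + t\<^sup>2 * \<sigma>\<^sup>2 / 2 + - (x - (m + t * \<sigma>\<^sup>2))\<^sup>2 / (2 * \<sigma>\<^sup>2)"
      using \<open>0 < \<sigma>\<close> by (simp add: field_simps power2_eq_square)
    then have "exp (- (x - m)\<^sup>2 / (2 * \<sigma>\<^sup>2)) * exp (t * x) = c * exp (- (x - (m + t * \<sigma>\<^sup>2))\<^sup>2 / (2 * \<sigma>\<^sup>2))"
      unfolding c_def exp_add[symmetric] by simp
    then show ?thesis unfolding normal_density_def by (simp add: mult_ac)
  qed
  have "(\<integral>\<^sup>+x. ennreal (exp (t * x)) \<partial>normal_law m v)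
      = (\<integral>\<^sup>+x. ennreal (normal_density m \<sigma> x) * ennreal (exp (t * x)) \<partial>lborel)"
    using False by (simp add: normal_law_def \<sigma>_def nn_integral_density)
  also have "\<dots> = (\<integral>\<^sup>+x. ennreal c * ennreal (normal_density (m + t * \<sigma>\<^sup>2) \<sigma> x) \<partial>lborel)"
    by (intro nn_integral_cong) (simp add: shift c_def flip: ennreal_mult)
  also have "\<dots> = ennreal c * (\<integral>\<^sup>+x. ennreal (normal_density (m + t * \<sigma>\<^sup>2) \<sigma> x) \<partial>lborel)"
    by (rule nn_integral_cmult) auto
  also have "(\<integral>\<^sup>+x. ennreal (normal_density (m + t * \<sigma>\<^sup>2) \<sigma> x) \<partial>lborel) = 1"
    using prob_space.emeasure_space_1[OF prob_space_normal_density[OF \<open>0 < \<sigma>\<close>]]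
    by (simp add: emeasure_density)
  finally show ?thesis by simp
qed

text \<open>exp(t max(0, x)) is either 1 or exp(t x), hence at most their sum.\<close>

lemma nn_integral_exp_max_0:
  assumes "prob_space L" and [measurable_cong]: "sets L = sets borel" and "0 \<le> t"
    and "(\<integral>\<^sup>+x. ennreal (exp (t * x)) \<partial>L) < \<infinity>"
  shows "(\<integral>\<^sup>+x. ennreal (exp (t * x)) \<partial>distr L borel (max 0)) < \<infinity>"
proof -
  interpret prob_space L by fact
  have "(\<integral>\<^sup>+x. ennreal (exp (t * x)) \<partial>distr L borel (max 0)) = (\<integral>\<^sup>+x. ennreal (exp (t * max 0 x)) \<partial>L)"
    by (rule nn_integral_distr) auto
  also have "\<dots> \<le> (\<integral>\<^sup>+x. 1 + ennreal (exp (t * x)) \<partial>L)"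
    by (intro nn_integral_mono) (auto simp: max_def)
  also have "\<dots> = 1 + (\<integral>\<^sup>+x. ennreal (exp (t * x)) \<partial>L)"
    by (subst nn_integral_add) (auto simp: emeasure_space_1)
  also have "\<dots> < \<infinity>" using assms(4) by simp
  finally show ?thesis .
qed

lemma nn_integral_exp_headway_laws:
  assumes "L \<in> headway_laws \<gamma> \<theta> Hbar Fbar Tn TN"
    and "0 < \<theta>" "0 \<le> t" "t < \<theta>" "0 \<le> \<gamma> * Tn"
  shows "(\<integral>\<^sup>+x. ennreal (exp (t * x)) \<partial>L) < \<infinity>"
proof -
  define R where "R = raw_headway_law \<gamma> \<theta> Hbar Fbar Tn TN"
  have "(\<integral>\<^sup>+x. ennreal (exp (t * x)) \<partial>distr R borel (max 0)) < \<infinity>"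
    unfolding R_def using assms
    by (intro nn_integral_exp_max_0 prob_space_raw_headway_law nn_integral_exp_raw_headway_law)
       (auto simp: raw_headway_law_def)
  \<comment> \<open>The variance is the integral of a square, hence nonnegative as
    \<open>normal_law\<close> requires here.\<close>
  moreover have "(\<integral>\<^sup>+x. ennreal (exp (t * x)) \<partial>distr (normal_approx R) borel (max 0)) < \<infinity>"
    unfolding normal_approx_def Let_def using assms(3)
    by (intro nn_integral_exp_max_0 prob_space_normal_law nn_integral_exp_normal_law)
       (auto simp: normal_law_def)
  ultimately show ?thesis
    using assms(1) by (auto simp: headway_laws_def Let_def R_def)
qed

section \<open>The balance equation of the station\<close>

lemma (in prob_space) prob_eq_sums_1:
  assumes [measurable]: "X \<in> measurable M (count_space UNIV)"
  shows "(\<lambda>k :: nat. prob {\<omega> \<in> space M. X \<omega> = k}) sums 1"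
proof -
  have "(\<lambda>k. prob {\<omega> \<in> space M. X \<omega> = k}) sums prob (\<Union>k. {\<omega> \<in> space M. X \<omega> = k})"
    by (rule finite_measure_UNION) (auto simp: disjoint_family_on_def)
  also have "(\<Union>k. {\<omega> \<in> space M. X \<omega> = k}) = space M" by auto
  finally show ?thesis by (simp add: prob_space)
qed

text \<open>f(X) is split over the events X = k, of which exactly one occurs. Banach-valued f covers
  both the complex generating function and the real means.\<close>

lemma (in prob_space) expectation_sums:
  fixes f :: "nat \<Rightarrow> 'b :: {banach, second_countable_topology}"
  assumes X [measurable]: "X \<in> measurable M (count_space UNIV)"
    and summable: "summable (\<lambda>k. prob {\<omega> \<in> space M. X \<omega> = k} * norm (f k))"
  shows "(\<lambda>k. prob {\<omega> \<in> space M. X \<omega> = k} *\<^sub>R f k) sums (\<integral>\<omega>. f (X \<omega>) \<partial>M)"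
proof -
  define A where "A k = {\<omega> \<in> space M. X \<omega> = k}" for k
  have A [measurable]: "A k \<in> events" for k unfolding A_def by measurable
  define g where "g k \<omega> = indicator (A k) \<omega> *\<^sub>R f k" for k \<omega>
  have g: "integrable M (g k)" for k
    unfolding g_def by (intro integrable_scaleR_left integrable_real_indicator A) (simp add: less_top[symmetric])
  have g_eq: "g k \<omega> = (if k = X \<omega> then f k else 0)" if "\<omega> \<in> space M" for k \<omega>
    using that by (auto simp: g_def A_def)
  have "(\<lambda>k. integral\<^sup>L M (g k)) sums (\<integral>\<omega>. (\<Sum>k. g k \<omega>) \<partial>M)"
  proof (rule sums_integral[OF g])
    show "AE \<omega> in M. summable (\<lambda>k. norm (g k \<omega>))"
      by (rule AE_I2, rule summable_finite[of "{X \<omega>}" for \<omega>]) (auto simp: g_eq)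
    have "(\<integral>\<omega>. norm (g k \<omega>) \<partial>M) = prob (A k) * norm (f k)" for k
      by (simp add: g_def)
    then show "summable (\<lambda>k. \<integral>\<omega>. norm (g k \<omega>) \<partial>M)"
      using summable by (simp add: A_def)
  qed
  moreover have "integral\<^sup>L M (g k) = prob {\<omega> \<in> space M. X \<omega> = k} *\<^sub>R f k" for k
    unfolding g_def[abs_def] A_def[symmetric]
    by (subst integral_scaleR_left) (auto simp: less_top[symmetric] intro!: integrable_real_indicator)
  moreover have "(\<integral>\<omega>. (\<Sum>k. g k \<omega>) \<partial>M) = (\<integral>\<omega>. f (X \<omega>) \<partial>M)"
  proof (rule Bochner_Integration.integral_cong[OF refl])
    fix \<omega> assume "\<omega> \<in> space M"
    then have "(\<lambda>k. g k \<omega>) = (\<lambda>k. if k = X \<omega> then f k else 0)"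
      by (auto simp: g_eq)
    then show "(\<Sum>k. g k \<omega>) = f (X \<omega>)"
      using sums_unique[OF sums_single[of "X \<omega>" f]] by simp
  qed
  ultimately show ?thesis by simp
qed

context station_model
begin

abbreviation arrival_prob :: "nat \<Rightarrow> real" where
  "arrival_prob k \<equiv> prob {\<omega> \<in> space M. Y 0 \<omega> = k}"

lemma arrival_prob_eq_expectation:
  "arrival_prob k = (\<integral>\<omega>. pmf (poisson_law (lam * H 0 \<omega>)) k \<partial>M)"
  using Y_given_H[of UNIV 0 k] by simp

lemma measurable_pmf_poisson_law [measurable]:
  "(\<lambda>\<omega>. pmf (poisson_law (lam * H 0 \<omega>)) k) \<in> borel_measurable M"
proof -
  have "(\<lambda>\<omega>. (lam * H 0 \<omega>) ^ k / fact k * exp (- (lam * H 0 \<omega>))) \<in> borel_measurable M"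
    by measurable
  then show ?thesis
    by (rule measurable_cong[THEN iffD1, rotated])
       (simp add: pmf_poisson_law lam_nonneg H_nonneg)
qed

lemma integrable_pmf_poisson_law: "integrable M (\<lambda>\<omega>. pmf (poisson_law (lam * H 0 \<omega>)) k)"
  by (rule integrable_const_bound[of _ 1]) (auto simp: pmf_le_1)

lemma ennreal_arrival_prob: "ennreal (arrival_prob k) = (\<integral>\<^sup>+\<omega>. ennreal (pmf (poisson_law (lam * H 0 \<omega>)) k) \<partial>M)"
  unfolding arrival_prob_eq_expectation
  by (rule nn_integral_eq_integral[symmetric, OF integrable_pmf_poisson_law]) simp

text \<open>The Poisson mass at 0 is exp(-r), positive for every headway, so its mean is
  positive.\<close>

lemma arrival_prob_0_pos: "0 < arrival_prob 0"
proof (rule ccontr)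
  assume "\<not> 0 < arrival_prob 0"
  then have "ennreal (arrival_prob 0) = 0" by (simp add: ennreal_eq_0_iff)
  then have "AE \<omega> in M. ennreal (pmf (poisson_law (lam * H 0 \<omega>)) 0) = 0"
    unfolding ennreal_arrival_prob by (subst (asm) nn_integral_0_iff_AE) auto
  moreover have "AE \<omega> in M. ennreal (pmf (poisson_law (lam * H 0 \<omega>)) 0) \<noteq> 0"
    by (rule AE_I2) (simp add: pmf_poisson_law lam_nonneg H_nonneg)
  ultimately have "AE \<omega> in M. False" by eventually_elim simp
  then show False by simp
qed

text \<open>By Tonelli, E rho^Y = E exp(lam (rho - 1) H), which is at most E exp(t H) as soon as lam
  (rho - 1) <= t.\<close>

lemma summable_arrival_prob_power:
  obtains \<rho> where "1 < \<rho>" "summable (\<lambda>k. arrival_prob k * \<rho> ^ k)"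
proof
  \<comment> \<open>Any t strictly between 0 and \<open>\<theta>\<close> would serve. The summand 1
    in \<open>lam + 1\<close> below covers \<open>lam\<close> = 0.\<close>
  define t where "t = \<theta> / 2"
  define \<rho> where "\<rho> = 1 + t / (lam + 1)"
  show "1 < \<rho>" using pos lam_nonneg by (simp add: \<rho>_def t_def)
  have le: "lam * (\<rho> - 1) \<le> t"
    using pos lam_nonneg by (simp add: \<rho>_def t_def field_simps)
  obtain L where "L \<in> headway_laws \<gamma> \<theta> Hbar Fbar Tn TN" and L: "distr M borel (H 0) = L"
    using H_law by blast
  then have "(\<integral>\<^sup>+x. ennreal (exp (t * x)) \<partial>distr M borel (H 0)) < \<infinity>"
    using pos gamma_nonneg nn_integral_exp_headway_laws[of L \<gamma> \<theta> Hbar Fbar Tn TN t]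
    by (simp add: t_def)
  then have fin: "(\<integral>\<^sup>+\<omega>. ennreal (exp (t * H 0 \<omega>)) \<partial>M) < \<infinity>"
    by (subst (asm) nn_integral_distr) auto
  have "(\<Sum>k. ennreal (arrival_prob k * \<rho> ^ k)) = (\<Sum>k. \<integral>\<^sup>+\<omega>. ennreal (pmf (poisson_law (lam * H 0 \<omega>)) k * \<rho> ^ k) \<partial>M)"
    using \<open>1 < \<rho>\<close> by (simp add: ennreal_mult'' ennreal_arrival_prob nn_integral_multc)
  also have "\<dots> = (\<integral>\<^sup>+\<omega>. (\<Sum>k. ennreal (pmf (poisson_law (lam * H 0 \<omega>)) k * \<rho> ^ k)) \<partial>M)"
    by (rule nn_integral_suminf[symmetric]) measurable
  also have "\<dots> = (\<integral>\<^sup>+\<omega>. ennreal (exp (lam * (\<rho> - 1) * H 0 \<omega>)) \<partial>M)"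
    using \<open>1 < \<rho>\<close>
    by (intro nn_integral_cong, subst suminf_pmf_poisson_law_power)
       (auto simp: lam_nonneg H_nonneg mult_ac)
  also have "\<dots> \<le> (\<integral>\<^sup>+\<omega>. ennreal (exp (t * H 0 \<omega>)) \<partial>M)"
    using le H_nonneg by (intro nn_integral_mono) (auto intro!: mult_right_mono)
  finally have "(\<Sum>k. ennreal (arrival_prob k * \<rho> ^ k)) < \<infinity>" using fin by simp
  then show "summable (\<lambda>k. arrival_prob k * \<rho> ^ k)"
    using \<open>1 < \<rho>\<close> by (intro summable_suminf_not_top) (auto simp: less_top)
qed

lemma pgf_sums:
  assumes "summable (\<lambda>k. arrival_prob k * \<rho> ^ k)" "norm z \<le> \<rho>"
  shows "(\<lambda>k. of_real (arrival_prob k) * z ^ k) sums pgf M (Y 0) z"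
proof -
  have "summable (\<lambda>k. arrival_prob k * norm (z ^ k))"
    by (rule summable_comparison_test[OF _ assms(1)])
       (use assms(2) in \<open>auto simp: norm_power intro!: exI[of _ 0] mult_left_mono power_mono\<close>)
  then have "(\<lambda>k. arrival_prob k *\<^sub>R z ^ k) sums (\<integral>\<omega>. z ^ Y 0 \<omega> \<partial>M)"
    by (intro expectation_sums measurable_Y)
  then show ?thesis by (simp add: pgf_def scaleR_conv_of_real)
qed

lemma mean_Y_sums:
  assumes "summable (\<lambda>k. arrival_prob k * \<rho> ^ k)" "1 < \<rho>"
  shows "(\<lambda>k. real k * arrival_prob k) sums mean M (Y 0)"
proof -
  \<comment> \<open>Bernoulli: rho^k >= 1 + k (rho - 1), so the geometric moment dominates the
    mean.\<close>
  have "real k \<le> \<rho> ^ k * (1 / (\<rho> - 1))" for k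
    using Bernoulli_inequality[of "\<rho> - 1" k] assms(2) by (simp add: field_simps)
  then have "arrival_prob k * real k \<le> arrival_prob k * (\<rho> ^ k * (1 / (\<rho> - 1)))" for k
    by (rule mult_left_mono) simp
  then have "summable (\<lambda>k. arrival_prob k * norm (real k))"
    by (intro summable_comparison_test[OF _ summable_mult2[OF assms(1), of "1 / (\<rho> - 1)"]] exI[of _ 0])
       (auto simp: mult.assoc)
  then have "(\<lambda>k. arrival_prob k *\<^sub>R real k) sums (\<integral>\<omega>. real (Y 0 \<omega>) \<partial>M)"
    by (intro expectation_sums measurable_Y)
  then show ?thesis by (simp add: mean_def mult.commute)
qed

section \<open>Transition probabilities and stationarity\<close>

lemma prob_S_eq: "prob {\<omega> \<in> space M. S 0 \<omega> = u} = (if u \<le> C then s u else 0)"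
proof (cases "u \<le> C")
  case False
  then have "{\<omega> \<in> space M. S 0 \<omega> = u} = {}" using S_le[of _ 0] by auto
  then show ?thesis using False by (simp only: measure_empty if_False)
qed (simp add: S_law)

lemma s_nonneg: "u \<le> C \<Longrightarrow> 0 \<le> s u"
  using S_law[of u 0] measure_nonneg[of M "{\<omega> \<in> space M. S 0 \<omega> = u}"] by simp

lemma s_sum: "(\<Sum>u\<le>C. s u) = 1"
proof -
  have "(\<lambda>u. if u \<le> C then s u else 0) sums 1"
    using prob_eq_sums_1[OF measurable_S[of 0]] by (simp add: prob_S_eq)
  moreover have "(\<lambda>u. if u \<le> C then s u else 0) sums (\<Sum>u\<le>C. if u \<le> C then s u else 0)"
    by (rule sums_finite) auto
  ultimately show ?thesis using sums_unique2 by fastforce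
qed

lemma mean_S: "mean M (S 0) = (\<Sum>u\<le>C. real u * s u)"
proof -
  have fin: "(\<lambda>u. (if u \<le> C then s u else 0) *\<^sub>R real u) sums (\<Sum>u\<le>C. (if u \<le> C then s u else 0) *\<^sub>R real u)"
    by (rule sums_finite) auto
  have "(\<lambda>u. prob {\<omega> \<in> space M. S 0 \<omega> = u} *\<^sub>R real u) sums (\<integral>\<omega>. real (S 0 \<omega>) \<partial>M)"
    using sums_summable[OF fin] by (intro expectation_sums measurable_S) (simp add: prob_S_eq)
  then have "(\<lambda>u. (if u \<le> C then s u else 0) *\<^sub>R real u) sums mean M (S 0)"
    by (simp only: prob_S_eq mean_def)
  then have "mean M (S 0) = (\<Sum>u\<le>C. (if u \<le> C then s u else 0) *\<^sub>R real u)"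
    using fin by (rule sums_unique2)
  also have "\<dots> = (\<Sum>u\<le>C. real u * s u)" by (intro sum.cong) auto
  finally show ?thesis .
qed

text \<open>Both events are preimages under coordinate 0 of the two independent blocks.\<close>

lemma indep_S_Y:
  "prob {\<omega> \<in> space M. S 0 \<omega> = u \<and> Y 0 \<omega> = k}
   = prob {\<omega> \<in> space M. S 0 \<omega> = u} * arrival_prob k"
proof -
  let ?N = "\<Pi>\<^sub>M l\<in>(UNIV :: nat set). count_space (UNIV :: nat set)"
  let ?N' = "count_space (UNIV :: nat set) \<Otimes>\<^sub>M
    (\<Pi>\<^sub>M l\<in>(UNIV :: nat set). (borel :: real measure) \<Otimes>\<^sub>M count_space (UNIV :: nat set))"
  have A: "(\<lambda>\<omega> l. S l \<omega>) -` {f \<in> space ?N. f 0 = u} \<inter> space M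
      \<in> sets (vimage_algebra (space M) (\<lambda>\<omega> l. S l \<omega>) ?N)"
    by (rule in_vimage_algebra) measurable
  have B: "(\<lambda>\<omega>. (Q 0 \<omega>, \<lambda>l. (H l \<omega>, Y l \<omega>))) -` {f \<in> space ?N'. snd (snd f 0) = k} \<inter> space M
      \<in> sets (vimage_algebra (space M) (\<lambda>\<omega>. (Q 0 \<omega>, \<lambda>l. (H l \<omega>, Y l \<omega>))) ?N')"
    by (rule in_vimage_algebra) measurable
  have A': "(\<lambda>\<omega> l. S l \<omega>) -` {f \<in> space ?N. f 0 = u} \<inter> space M = {\<omega> \<in> space M. S 0 \<omega> = u}"
    by (auto simp: space_PiM)
  have B': "(\<lambda>\<omega>. (Q 0 \<omega>, \<lambda>l. (H l \<omega>, Y l \<omega>))) -` {f \<in> space ?N'. snd (snd f 0) = k} \<inter> space M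
      = {\<omega> \<in> space M. Y 0 \<omega> = k}"
    by (auto simp: space_pair_measure space_PiM)
  have "prob ({\<omega> \<in> space M. S 0 \<omega> = u} \<inter> {\<omega> \<in> space M. Y 0 \<omega> = k})
      = prob {\<omega> \<in> space M. S 0 \<omega> = u} * arrival_prob k"
    using indep_setD[OF S_indep_Q_HY[unfolded indep_rvs_def] A B] unfolding A' B' .
  also have "{\<omega> \<in> space M. S 0 \<omega> = u} \<inter> {\<omega> \<in> space M. Y 0 \<omega> = k}
      = {\<omega> \<in> space M. S 0 \<omega> = u \<and> Y 0 \<omega> = k}" by auto
  finally show ?thesis .
qed

text \<open>Split by the space u. If j > k + u, more than k stay behind and the case is impossible;
  otherwise the arrivals must number k - (j - u).\<close>

lemma queue_trans_eq:
  "queue_trans M S Y j k = (\<Sum>u\<le>C. if j \<le> k + u then s u * arrival_prob (k - (j - u)) else 0)"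
proof -
  have "{\<omega> \<in> space M. (j - S 0 \<omega>) + Y 0 \<omega> = k}
      = (\<Union>u\<in>{..C}. {\<omega> \<in> space M. S 0 \<omega> = u \<and> (j - u) + Y 0 \<omega> = k})"
    using S_le[of _ 0] by auto
  then have "queue_trans M S Y j k = (\<Sum>u\<le>C. prob {\<omega> \<in> space M. S 0 \<omega> = u \<and> (j - u) + Y 0 \<omega> = k})"
    unfolding queue_trans_def
    by (simp only:) (rule finite_measure_finite_Union, auto simp: disjoint_family_on_def)
  also have "\<dots> = (\<Sum>u\<le>C. if j \<le> k + u then s u * arrival_prob (k - (j - u)) else 0)"
  proof (rule sum.cong[OF refl])
    fix u assume "u \<in> {..C}"
    show "prob {\<omega> \<in> space M. S 0 \<omega> = u \<and> (j - u) + Y 0 \<omega> = k}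
        = (if j \<le> k + u then s u * arrival_prob (k - (j - u)) else 0)"
    proof (cases "j \<le> k + u")
      case True
      then have "(j - u) + y = k \<longleftrightarrow> y = k - (j - u)" for y by auto
      then show ?thesis using True \<open>u \<in> {..C}\<close> by (simp add: indep_S_Y prob_S_eq)
    next
      case False
      then have "{\<omega> \<in> space M. S 0 \<omega> = u \<and> (j - u) + Y 0 \<omega> = k} = {}" by auto
      then show ?thesis using False by (simp only: measure_empty if_False)
    qed
  qed
  finally show ?thesis .
qed

text \<open>At most C passengers board, so no j > k + C leads to k and the stationarity series is a
  finite sum.\<close>

lemma stationary_balance:
  assumes "stationary_queue M S Y q"
  shows "pmf q k = (\<Sum>u\<le>C. s u * (\<Sum>j\<le>k + u. pmf q j * arrival_prob (k - (j - u))))"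
proof -
  have "(\<lambda>j. pmf q j * queue_trans M S Y j k) sums (\<Sum>j\<le>k + C. pmf q j * queue_trans M S Y j k)"
    by (rule sums_finite) (auto simp: queue_trans_eq intro!: sum.neutral)
  then have "pmf q k = (\<Sum>j\<le>k + C. pmf q j * queue_trans M S Y j k)"
    using assms sums_unique2 unfolding stationary_queue_def by blast
  also have "\<dots> = (\<Sum>u\<le>C. \<Sum>j\<le>k + C. pmf q j * (if j \<le> k + u then s u * arrival_prob (k - (j - u)) else 0))"
    unfolding queue_trans_eq sum_distrib_left by (rule sum.swap)
  also have "\<dots> = (\<Sum>u\<le>C. \<Sum>j\<le>k + u. s u * (pmf q j * arrival_prob (k - (j - u))))"
    by (intro sum.cong refl sum.mono_neutral_cong_right) auto
  finally show ?thesis by (simp only: sum_distrib_left)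
qed

lemma stationary_queue_equation:
  assumes "stationary_queue M S Y q" "0 < s C" "1 < \<rho>" "summable (\<lambda>k. arrival_prob k * \<rho> ^ k)"
  shows "queue_equation C s arrival_prob (pmf q) (pgf M (Y 0)) \<rho>"
proof
  show "pmf q sums 1"
    using measure_pmf.prob_eq_sums_1[of "\<lambda>x. x" q] by (simp add: pmf.rep_eq)
  show "pmf q k = (\<Sum>u\<le>C. s u * (\<Sum>j\<le>k + u. pmf q j * arrival_prob (k - (j - u))))" for k
    by (rule stationary_balance[OF assms(1)])
  show "(\<lambda>k. of_real (arrival_prob k) * z ^ k) sums pgf M (Y 0) z" if "norm z < \<rho>" for z
    using that by (intro pgf_sums[OF assms(4)]) simp
qed (use assms C_ge_1 s_nonneg s_sum arrival_prob_0_pos prob_eq_sums_1[OF measurable_Y[of 0]] in auto)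

end

theorem proposition4:
  fixes M :: "'a measure"
    and N C n :: nat
    and lam T :: "nat \<Rightarrow> real"
    and s :: "nat \<Rightarrow> nat \<Rightarrow> real"
    and \<gamma> \<theta> Hbar Fbar :: real
    and Q S Y :: "nat \<Rightarrow> nat \<Rightarrow> 'a \<Rightarrow> nat"
    and H :: "nat \<Rightarrow> nat \<Rightarrow> 'a \<Rightarrow> real"
    and q :: "nat pmf"
    and z :: "nat \<Rightarrow> complex"
  assumes "n \<in> {1..N}"
    and "station_model M C (lam n) (s n) \<gamma> \<theta> Hbar Fbar (T n) (T N) (Q n) (S n) (H n) (Y n)"
    and "stationary_queue M (S n) (Y n) q"
    and "s n C > 0"
    and "lists_unit_disk_roots (station_fn C (s n) (pgf M (Y n 0))) C z"
    and "z 0 = 1"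
  shows "mean M (S n 0) = (\<Sum>u\<le>C. real u * s n u) \<and>
         complex_of_real (pmf q 0) =
           of_real (1 / s n C * (mean M (S n 0) - mean M (Y n 0))) *
             (\<Prod>i=1..<C. z i / (z i - 1)) \<and>
         (\<forall>j\<le>C. eta C z j \<in> \<real>) \<and>
         invertible_mat (Lambda_mat C (s n)) \<and>
         mat_of_row (Matrix.vec C (pmf q)) =
           mat_of_row (map_vec Re (eta_tilde C (s n) (pmf q 0) z)) *
             the (mat_inverse (Lambda_mat C (s n)))"
proof -
  interpret station_model M C "lam n" "s n" \<gamma> \<theta> Hbar Fbar "T n" "T N" "Q n" "S n" "H n" "Y n"
    by fact
  obtain \<rho> where \<rho>: "1 < \<rho>" "summable (\<lambda>k. arrival_prob k * \<rho> ^ k)"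
    by (rule summable_arrival_prob_power)
  interpret E: queue_equation C "s n" arrival_prob "pmf q" "pgf M (Y n 0)" \<rho>
    using assms \<rho> by (intro stationary_queue_equation)
  note roots = \<open>lists_unit_disk_roots (station_fn C (s n) (pgf M (Y n 0))) C z\<close>
  have sC: "s n C \<noteq> 0" using \<open>s n C > 0\<close> by simp
  \<comment> \<open>\<open>Re\<close> only changes the type here: the entries are real by
    \<open>eta_real\<close>.\<close>
  have "map_vec Re (eta_tilde C (s n) (pmf q 0) z)
      = Matrix.vec C (\<lambda>j. Re (of_real (s n C) * of_real (pmf q 0) * eta C z j))"
    by (auto simp: eta_tilde_def)
  then have "mat_of_row (Matrix.vec C (pmf q)) =
      mat_of_row (map_vec Re (eta_tilde C (s n) (pmf q 0) z)) * the (mat_inverse (Lambda_mat C (s n)))"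
    using mat_of_row_eq_mult_inverse[of "s n" C "pmf q", OF sC E.Re_eta_tilde[OF roots]] by simp
  then show ?thesis
    using E.q_0_eq[OF roots \<open>z 0 = 1\<close> mean_Y_sums[OF \<rho>(2,1)]] E.eta_real[OF roots]
      invertible_Lambda_mat[of "s n" C, OF sC]
    by (simp only: mean_S) blast
qed

end
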